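(* Let $p$ be a nonzero integer and let $\phi,\psi$ be two bounded radial functions on $\mathbb{D}$. If $T_{e^{ip\theta}\phi}$ commutes with $T_\psi$ on $L^2_h$, that is $T_{e^{ip\theta}\phi}T_\psi=T_\psi T_{e^{ip\theta}\phi}$, then $\phi$ is zero or $\psi$ is constant.
   Context: $\mathbb{D}$ is the open unit disk of the complex plane and $dA=r\,dr\,\frac{d\theta}{\pi}$ is normalized Lebesgue measure on $\mathbb{D}$. The harmonic Bergman space $L^2_h$ is the closed subspace of $L^2(\mathbb{D},dA)$ consisting of all harmonic functions on $\mathbb{D}$, and $Q$ is the orthogonal projection of $L^2(\mathbb{D},dA)$ onto $L^2_h$. For a bounded (measurable) function $f$ on $\mathbb{D}$, the Toeplitz operator $T_f:L^2_h\to L^2_h$ with symbol $f$ is $T_f(u)=Q(fu)$. A function $\phi$ on $\mathbb{D}$ is radial if $\phi(z)$ depends only on $r=|z|$; $e^{ip\theta}\phi$ denotes the function $re^{i\theta}\mapsto e^{ip\theta}\phi(r)$. Equality of symbols is understood almost everywhere. *)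

theory Defs
  imports "HOL-Analysis.Analysis"
begin

abbreviation unit_disk :: "complex set" where
  "unit_disk \<equiv> ball 0 1"

definition disk_measure :: "complex measure" where
  "disk_measure = density (lebesgue_on unit_disk) (\<lambda>_. ennreal (1 / pi))"

definition L2_disk :: "(complex \<Rightarrow> complex) set" where
  "L2_disk = {f. f \<in> borel_measurable disk_measure \<and>
                 integrable disk_measure (\<lambda>z. (cmod (f z))\<^sup>2)}"

definition L2_inner :: "(complex \<Rightarrow> complex) \<Rightarrow> (complex \<Rightarrow> complex) \<Rightarrow> complex" where
  "L2_inner f g = (LINT z|disk_measure. f z * cnj (g z))"

(* u is complex-valued and of class C^2 in the real sense on S, with
   u_xx + u_yy = 0.  The functions ux, uy, uxx, ... are the partial derivatives with
   respect to x = Re z and y = Im z; continuity of ux and uy follows from their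
   differentiability. *)
definition harmonic_on :: "(complex \<Rightarrow> complex) \<Rightarrow> complex set \<Rightarrow> bool" where
  "harmonic_on u S \<longleftrightarrow>
     (\<exists>ux uy uxx uxy uyx uyy.
        (\<forall>z\<in>S.
           (u has_derivative (\<lambda>h. Re h *\<^sub>R ux z + Im h *\<^sub>R uy z)) (at z) \<and>
           (ux has_derivative (\<lambda>h. Re h *\<^sub>R uxx z + Im h *\<^sub>R uxy z)) (at z) \<and>
           (uy has_derivative (\<lambda>h. Re h *\<^sub>R uyx z + Im h *\<^sub>R uyy z)) (at z) \<and>
           uxx z + uyy z = 0) \<and>
        continuous_on S uxx \<and> continuous_on S uxy \<and>
        continuous_on S uyx \<and> continuous_on S uyy)"

(* Functions on the disk are modelled by total functions on the complex plane.  A class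
   in L2 contains at most one function harmonic on the disk, so the subspace can be
   modelled by functions instead of classes; the irrelevant values off the disk are
   normalised to 0, which makes equality in this set equality on the disk. *)
definition harmonic_bergman :: "(complex \<Rightarrow> complex) set" where
  "harmonic_bergman =
     {u. harmonic_on u unit_disk \<and> u \<in> L2_disk \<and> (\<forall>z. z \<notin> unit_disk \<longrightarrow> u z = 0)}"

(* The harmonic Bergman space is a closed subspace of L2, so for f in L2_disk there is
   exactly one such u; for other f the value is unspecified. *)
definition bergman_proj :: "(complex \<Rightarrow> complex) \<Rightarrow> (complex \<Rightarrow> complex)" where
  "bergman_proj f =
     (THE u. u \<in> harmonic_bergman \<and>
             (\<forall>v\<in>harmonic_bergman. L2_inner (\<lambda>z. f z - u z) v = 0))"

definition toeplitz :: "(complex \<Rightarrow> complex) \<Rightarrow> (complex \<Rightarrow> complex) \<Rightarrow> (complex \<Rightarrow> complex)" where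
  "toeplitz f u = bergman_proj (\<lambda>z. f z * u z)"

definition bounded_symbol :: "(complex \<Rightarrow> complex) \<Rightarrow> bool" where
  "bounded_symbol f \<longleftrightarrow> f \<in> borel_measurable disk_measure \<and> bounded (f ` unit_disk)"

definition radial :: "(complex \<Rightarrow> complex) \<Rightarrow> bool" where
  "radial f \<longleftrightarrow> (\<forall>z\<in>unit_disk. \<forall>w\<in>unit_disk. cmod z = cmod w \<longrightarrow> f z = f w)"

(* The symbol r e^(i t) |-> e^(i p t) phi(r); the choice of the branch of the argument
   is immaterial because p is an integer. *)
definition quasihomogeneous :: "int \<Rightarrow> (complex \<Rightarrow> complex) \<Rightarrow> (complex \<Rightarrow> complex)" where
  "quasihomogeneous p \<phi> = (\<lambda>z. cis (of_int p * Arg z) * \<phi> (of_real (cmod z)))"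

end

theory Submission
  imports Defs "HOL-Complex_Analysis.Complex_Analysis"
begin

text \<open>
  Let \<open>e_m\<close> be the monomial \<open>r^\<bar>m\<bar> e^(i m t)\<close>. Rotation invariance shows that \<open>T_\<psi>\<close> maps \<open>e_m\<close> to
  \<open>\<Lambda>(\<bar>m\<bar>) e_m\<close> and that the other operator maps \<open>e_m\<close> to a multiple of \<open>e_(m+p)\<close> whose coefficient is, up
  to a nonzero factor, the moment of \<open>\<phi>\<close> of order \<open>\<bar>m\<bar> + \<bar>m + p\<bar>\<close>. With \<open>q = \<bar>p\<bar>\<close>, commutation says
  that for each \<open>n\<close> either the moment of \<open>\<phi>\<close> of order \<open>2 n + q\<close> vanishes or \<open>\<Lambda>(n) = \<Lambda>(n + q)\<close>. As
  \<open>\<Sum> 1/n\<close> diverges, it diverges over one of these two sets of \<open>n\<close>. Both conditions say that a bounded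
  holomorphic function on the right half-plane, built from Mellin transforms, vanishes at \<open>n\<close>, so by
  Blaschke's condition one of them holds for all \<open>n\<close>. In the first case all moments of \<open>\<phi>\<close> (times a power
  of \<open>r\<close>) vanish and \<open>\<phi> = 0\<close>. In the second case \<open>\<Lambda>\<close> is constant on the multiples of \<open>q\<close>, and
  the same argument applied to \<open>\<psi> - \<Lambda>(q)\<close> shows that \<open>\<psi>\<close> is constant.
\<close>

section \<open>Zeros of bounded holomorphic functions\<close>

text \<open>Two features shape the details. \<open>bergman_proj\<close> is a definite description,
  so a value of it is obtained by exhibiting a candidate and checking orthogonality against every
  function of \<open>harmonic_bergman\<close>, not merely against monomials. Such a function is
  \<open>F + cnj G\<close> with \<open>F\<close>, \<open>G\<close> holomorphic, but square
  integrability is known for the sum only. Hence the integrals are cut off at a radius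
  \<open>R < 1\<close>, where both Taylor series can be integrated term by term, and
  \<open>R\<close> tends to 1 afterwards. Integration over the angle is replaced by invariance under
  one rotation, by \<open>pi / m\<close>, which negates a function of degree \<open>m\<close>.

  The condition \<Lambda>(n) = \<Lambda>(n + q) compares quotients of Mellin transforms.
  Cross-multiplying gives a function that is holomorphic and bounded whatever the zeros of the
  denominators. It yields period \<open>q\<close> rather than constancy, so the last step works
  along the multiples of \<open>q\<close>, whose reciprocals still have a divergent sum. The
  transform variable is |z|^2, which makes the integer \<open>n\<close> correspond to the moment of
  order \<open>2 n\<close>.\<close>

text \<open>Unlike the library version, this allows unimodular values, so it can be iterated.\<close>
lemma Schwarz_Lemma_le:
  assumes hol: "f holomorphic_on ball 0 1" and f0: "f 0 = 0"
    and le: "\<And>z. norm z < 1 \<Longrightarrow> norm (f z) \<le> 1" and z: "norm z < 1"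
  shows "norm (f z) \<le> norm z"
proof (rule field_le_mult_one_interval)
  fix t :: real assume t: "0 < t" "t < 1"
  have "norm (of_real t * f z) \<le> norm z"
  proof (rule Schwarz_Lemma(1)[where f = "\<lambda>z. of_real t * f z"])
    show "(\<lambda>z. of_real t * f z) holomorphic_on ball 0 1"
      by (intro holomorphic_intros hol)
    show "norm (of_real t * f w) < 1" if "norm w < 1" for w
    proof -
      have "norm (of_real t * f w) = t * norm (f w)" using t by (simp add: norm_mult)
      also have "\<dots> \<le> t" using t le[OF that] by (simp add: mult_left_le)
      also have "t < 1" by (rule t)
      finally show ?thesis .
    qed
  qed (use f0 z in auto)
  then show "t * norm (f z) \<le> norm z" using t by (simp add: norm_mult)
qed

lemma one_minus_cnj_mult_ne_0:
  assumes "norm a < 1" "norm w < 1"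
  shows "1 - cnj a * w \<noteq> 0"
proof
  assume "1 - cnj a * w = 0"
  then have "cnj a * w = 1" by simp
  then have "norm (cnj a * w) = 1" by simp
  moreover have "norm (cnj a * w) < 1 * 1" unfolding norm_mult
    using assms by (intro mult_strict_mono') auto
  ultimately show False by simp
qed

text \<open>Rests on |1 - cnj a w|^2 - |w - a|^2 = (1 - |a|^2)(1 - |w|^2). It measures how far a
  Blaschke factor falls below 1, which is the quantity to be summed over the zeros.\<close>

lemma cmod_sq_one_minus_Moebius:
  assumes "norm a < 1" "norm w < 1"
  shows "1 - (norm (Moebius_function 0 a w))\<^sup>2
    = (1 - (norm a)\<^sup>2) * (1 - (norm w)\<^sup>2) / (norm (1 - cnj a * w))\<^sup>2"
proof -
  have ne: "1 - cnj a * w \<noteq> 0" by (rule one_minus_cnj_mult_ne_0) (use assms in auto)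
  have key: "(norm (1 - cnj a * w))\<^sup>2 - (norm (w - a))\<^sup>2 = (1 - (norm a)\<^sup>2) * (1 - (norm w)\<^sup>2)"
    unfolding cmod_power2 by (simp add: power2_eq_square algebra_simps)
  have "(norm (Moebius_function 0 a w))\<^sup>2 = (norm (w - a))\<^sup>2 / (norm (1 - cnj a * w))\<^sup>2"
    by (simp add: Moebius_function_simple norm_divide power_divide)
  then show ?thesis using key ne by (simp add: field_simps)
qed

text \<open>Moving \<open>a\<close> to the origin by a disk automorphism and applying Schwarz bounds
  |f| by the modulus of the Moebius factor. The quotient is then again bounded by 1, so the step can
  be repeated for further zeros.\<close>

lemma holomorphic_disk_divide_zero:
  assumes hol: "f holomorphic_on ball 0 1" and le: "\<And>z. norm z < 1 \<Longrightarrow> norm (f z) \<le> 1"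
    and a: "norm a < 1" and fa: "f a = 0"
  obtains g where "g holomorphic_on ball 0 1" "\<And>z. norm z < 1 \<Longrightarrow> norm (g z) \<le> 1"
    "\<And>z. norm z < 1 \<Longrightarrow> f z = Moebius_function 0 a z * g z"
proof
  \<comment> \<open>The Moebius factor is (z - a) / (1 - cnj a z), so dividing by it multiplies the
    difference quotient of \<open>f\<close> by 1 - cnj a z; \<open>deriv f a\<close> fills the
    removable singularity.\<close>
  define g where "g = (\<lambda>z. (1 - cnj a * z) * (if z = a then deriv f a else (f z - f a) / (z - a)))"
  have ne: "1 - cnj a * z \<noteq> 0" if "norm z < 1" for z
    by (rule one_minus_cnj_mult_ne_0[OF a that])
  show holg: "g holomorphic_on ball 0 1"
    unfolding g_def by (intro holomorphic_intros pole_lemma hol) (use a in auto)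
  show fg: "f z = Moebius_function 0 a z * g z" if "norm z < 1" for z
    using ne[OF that] fa by (auto simp: g_def Moebius_function_simple)
  have off: "norm (g z) \<le> 1" if z: "norm z < 1" and za: "z \<noteq> a" for z
  proof -
    define w where "w = Moebius_function 0 a z"
    have w: "norm w < 1" unfolding w_def by (intro Moebius_function_norm_lt_1 a z)
    have zw: "Moebius_function 0 (-a) w = z"
      unfolding w_def by (rule Moebius_function_compose) (use a z in auto)
    have "norm ((f \<circ> Moebius_function 0 (-a)) w) \<le> norm w"
    proof (rule Schwarz_Lemma_le)
      show "f \<circ> Moebius_function 0 (- a) holomorphic_on ball 0 1"
        by (rule holomorphic_on_compose_gen[OF _ hol])
          (use a in \<open>auto intro!: Moebius_function_holomorphic Moebius_function_norm_lt_1\<close>)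
      show "norm ((f \<circ> Moebius_function 0 (- a)) u) \<le> 1" if "norm u < 1" for u
        using le[OF Moebius_function_norm_lt_1[of "- a" u]] a that by simp
    qed (use w fa in \<open>simp_all add: Moebius_function_of_zero\<close>)
    then have "norm (f z) \<le> norm w" using zw by simp
    moreover have "w \<noteq> 0" using za ne[OF z] by (simp add: w_def Moebius_function_simple)
    ultimately show ?thesis using fg[OF z] by (simp add: w_def[symmetric] norm_mult)
  qed
  show "norm (g z) \<le> 1" if z: "norm z < 1" for z
  proof (cases "z = a")
    case True
    \<comment> \<open>At \<open>a\<close> itself Schwarz only says 0 \<le> 0, so the bound is
      carried over from nearby points by continuity.\<close>
    have "isCont g a"
      using holomorphic_on_imp_continuous_on[OF holg] a
      by (simp add: continuous_on_eq_continuous_at)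
    then have "((\<lambda>z. norm (g z)) \<longlongrightarrow> norm (g a)) (at a)"
      unfolding isCont_def by (rule tendsto_norm)
    moreover have "eventually (\<lambda>z. norm (g z) \<le> 1) (at a)"
    proof -
      have "eventually (\<lambda>z. z \<in> ball 0 1) (at a)"
        by (rule eventually_at_in_open') (use a in auto)
      moreover have "eventually (\<lambda>z. z \<noteq> a) (at a)" by (simp add: eventually_at_filter)
      ultimately show ?thesis by eventually_elim (use off in auto)
    qed
    ultimately have "norm (g a) \<le> 1" by (intro tendsto_upperbound[of _ _ "at a"]) auto
    then show ?thesis using True by simp
  qed (use off z in auto)
qed

text \<open>Induction over the zeros with \<open>f\<close> arbitrary: dividing by one Moebius factor
  keeps the bound 1, and the remaining zeros survive because that factor vanishes only at its own
  zero.\<close>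

lemma norm_le_Blaschke_product:
  assumes "finite A" and "f holomorphic_on ball 0 1" and "\<And>z. norm z < 1 \<Longrightarrow> norm (f z) \<le> 1"
    and "\<And>a. a \<in> A \<Longrightarrow> norm a < 1 \<and> f a = 0" and "norm w < 1"
  shows "norm (f w) \<le> (\<Prod>a\<in>A. norm (Moebius_function 0 a w))"
  using assms
proof (induction A arbitrary: f rule: finite_induct)
  case (insert a A)
  then have "norm a < 1" "f a = 0" by auto
  then obtain g where g: "g holomorphic_on ball 0 1" "\<And>z. norm z < 1 \<Longrightarrow> norm (g z) \<le> 1"
    and fg: "\<And>z. norm z < 1 \<Longrightarrow> f z = Moebius_function 0 a z * g z"
    using holomorphic_disk_divide_zero[OF insert.prems(1,2)] by blast
  have "g b = 0" if b: "b \<in> A" for b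
  proof -
    have b1: "norm b < 1" "f b = 0" "b \<noteq> a" using insert b by auto
    have "1 - cnj a * b \<noteq> 0" by (rule one_minus_cnj_mult_ne_0) (use b1 \<open>norm a < 1\<close> in auto)
    then show ?thesis using b1 fg[of b] by (auto simp: Moebius_function_simple)
  qed
  then have "norm (g w) \<le> (\<Prod>a\<in>A. norm (Moebius_function 0 a w))"
    using insert.prems by (intro insert.IH g) auto
  then show ?case
    using insert.hyps insert.prems fg[of w] by (simp add: norm_mult mult_left_mono)
qed auto

text \<open>The Cayley map pulls the zero n back to a = (n - 1)/(n + 1), for which 1 - |a|^2 is
  comparable to 1/n. If the sum of 1/n diverges, the finite Blaschke products bounding |f w| become
  arbitrarily small.\<close>

lemma bounded_holomorphic_halfplane_eq_0:
  fixes F :: "complex \<Rightarrow> complex" and S :: "nat set"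
  assumes hol: "F holomorphic_on {z. Re z > 0}" and bd: "\<And>z. Re z > 0 \<Longrightarrow> norm (F z) \<le> B"
    and S: "\<And>n. n \<in> S \<Longrightarrow> n > 0 \<and> F (of_nat n) = 0"
    and div: "\<not> (\<lambda>n. 1 / real n) summable_on S"
    and z: "Re z > 0"
  shows "F z = 0"
proof -
  \<comment> \<open>Strictly positive, so dividing by it is legitimate even if \<open>B\<close> is
    0.\<close>
  define C where "C = max B 1"
  have C: "C > 0" "\<And>z. Re z > 0 \<Longrightarrow> norm (F z) \<le> C" using bd by (auto simp: C_def le_max_iff_disj)
  define T :: "complex \<Rightarrow> complex" where "T = (\<lambda>w. (1 + w) / (1 - w))"
  define f where "f = (\<lambda>w. F (T w) / of_real C)"
  have Re_T: "Re (T w) > 0" if "norm w < 1" for w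
  proof -
    have "w \<noteq> 1" using that by auto
    have "Re (T w) = (1 - (norm w)\<^sup>2) / (norm (1 - w))\<^sup>2"
      unfolding cmod_power2 by (simp add: T_def Re_divide power2_eq_square algebra_simps)
    moreover have "(norm w)\<^sup>2 < 1" using that by (simp add: power_less_one_iff)
    ultimately show ?thesis using \<open>w \<noteq> 1\<close> by auto
  qed
  have holf: "f holomorphic_on ball 0 1"
  proof -
    have "F \<circ> T holomorphic_on ball 0 1"
      unfolding T_def
      by (rule holomorphic_on_compose_gen[OF _ hol])
        (use Re_T in \<open>auto simp: T_def intro!: holomorphic_intros\<close>)
    then have "(\<lambda>w. F (T w)) holomorphic_on ball 0 1" by (simp add: o_def)
    then show ?thesis unfolding f_def
      using C(1) by (intro holomorphic_on_divide holomorphic_on_const) auto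
  qed
  have lef: "norm (f w) \<le> 1" if "norm w < 1" for w
    using C(2)[OF Re_T[OF that]] C(1) by (simp add: f_def norm_divide)
  define w where "w = (z - 1) / (z + 1)"
  have z1: "z + 1 \<noteq> 0" using z by (auto simp: complex_eq_iff)
  have Tw: "T w = z" using z1 by (simp add: T_def w_def divide_simps)
  have w: "norm w < 1"
  proof -
    have "(norm (z - 1))\<^sup>2 < (norm (z + 1))\<^sup>2"
      unfolding cmod_power2 using z by (simp add: power2_eq_square algebra_simps)
    then have "norm (z - 1) < norm (z + 1)" by (simp add: power2_less_imp_less)
    then show ?thesis using z1 by (simp add: w_def norm_divide)
  qed
  \<comment> \<open>Since |1 - cnj a w| \<le> 2, the previous identity gives 1 - |Moebius factor|^2
    \<ge> d (1 - |a|^2), with all dependence on \<open>w\<close> collected in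
    \<open>d\<close>.\<close>
  define d where "d = (1 - (norm w)\<^sup>2) / 4"
  have d: "d > 0" using w by (auto simp: d_def power_less_one_iff)
  define a :: "nat \<Rightarrow> complex" where "a = (\<lambda>n. of_real ((real n - 1) / (real n + 1)))"
  have a_bounds: "0 \<le> (real n - 1) / (real n + 1)" "(real n - 1) / (real n + 1) < 1" if "n \<in> S" for n
    using S[OF that] by (auto simp: divide_simps)
  have a_norm: "norm (a n) = (real n - 1) / (real n + 1)" if "n \<in> S" for n
    unfolding a_def norm_of_real using a_bounds(1)[OF that] by (rule abs_of_nonneg)
  have Ta: "T (a n) = of_nat n" for n
  proof -
    have *: "1 + of_nat n \<noteq> (0::complex)" by (metis of_nat_Suc of_nat_neq_0)
    have "1 - a n = 2 / (1 + of_nat n)" "1 + a n = 2 * of_nat n / (1 + of_nat n)"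
      using * by (auto simp: a_def divide_simps add.commute)
    then show ?thesis using * by (simp add: T_def)
  qed
  have inj_a: "inj_on a A" for A
    by (rule inj_onI) (metis Ta of_nat_eq_iff)
  have factor: "(norm (Moebius_function 0 (a n) w))\<^sup>2 \<le> exp (- d * (1 / real n))" if n: "n \<in> S" for n
  proof -
    have an: "norm (a n) < 1" using a_bounds[OF n] a_norm[OF n] by simp
    have n0: "real n > 0" using S[OF n] by simp
    have ne: "norm (1 - cnj (a n) * w) > 0"
      using one_minus_cnj_mult_ne_0[OF an w] by simp
    have "norm (cnj (a n) * w) \<le> 1 * 1" unfolding norm_mult
        using w an by (intro mult_mono) auto
    then have up: "norm (1 - cnj (a n) * w) \<le> 2"
      using norm_triangle_ineq4[of 1 "cnj (a n) * w"] by simp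
    have le4: "(norm (1 - cnj (a n) * w))\<^sup>2 \<le> 4"
      using power_mono[OF up, of 2] by simp
    have "1 / real n \<le> 1 - (norm (a n))\<^sup>2"
    proof -
      have "1 - (norm (a n))\<^sup>2 = 4 * real n / (real n + 1)\<^sup>2"
      proof -
        have "1 - (norm (a n))\<^sup>2 = ((real n + 1)\<^sup>2 - (real n - 1)\<^sup>2) / (real n + 1)\<^sup>2"
          unfolding a_norm[OF n] using n0 by (simp add: power_divide diff_divide_distrib[of _ _ "(_ + 1)\<^sup>2"])
        also have "(real n + 1)\<^sup>2 - (real n - 1)\<^sup>2 = 4 * real n"
          by (simp add: power2_eq_square algebra_simps)
        finally show ?thesis .
      qed
      moreover have "(real n + 1)\<^sup>2 \<le> (2 * real n)\<^sup>2"
        using S[OF n] by (intro power_mono) auto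
      then have "1 / real n \<le> 4 * real n / (real n + 1)\<^sup>2"
        using n0 by (simp add: field_simps power2_eq_square)
      ultimately show ?thesis by simp
    qed
    then have "d * (1 / real n) \<le> d * (1 - (norm (a n))\<^sup>2)"
      using d by (intro mult_left_mono) auto
    also have "\<dots> = (1 - (norm (a n))\<^sup>2) * (1 - (norm w)\<^sup>2) / 4"
      by (simp add: d_def)
    also have "\<dots> \<le> (1 - (norm (a n))\<^sup>2) * (1 - (norm w)\<^sup>2) / (norm (1 - cnj (a n) * w))\<^sup>2"
      using ne le4 an w by (intro divide_left_mono mult_nonneg_nonneg mult_pos_pos)
        (auto simp: power_le_one)
    also have "\<dots> = 1 - (norm (Moebius_function 0 (a n) w))\<^sup>2"
      using cmod_sq_one_minus_Moebius[OF an w] by simp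
    finally have "(norm (Moebius_function 0 (a n) w))\<^sup>2 \<le> 1 + (- d * (1 / real n))" by simp
    also have "\<dots> \<le> exp (- d * (1 / real n))" by (rule exp_ge_add_one_self)
    finally show ?thesis .
  qed
  have "norm (f w) = 0"
  proof (rule ccontr)
    assume "norm (f w) \<noteq> 0"
    then have pos: "norm (f w) > 0" by simp
    \<comment> \<open>Solves |f w|^2 \<le> exp (- d * sum) for the sum; the bound is the same for
      every finite set of zeros.\<close>
    define K where "K = - ln ((norm (f w))\<^sup>2) / d"
    have "(\<lambda>n. 1 / real n) summable_on S"
    proof (rule nonneg_bdd_above_summable_on)
      show "bdd_above (sum (\<lambda>n. 1 / real n) ` {F. F \<subseteq> S \<and> finite F})"
      proof (rule bdd_aboveI2)
        fix A assume "A \<in> {F. F \<subseteq> S \<and> finite F}"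
        then have A: "A \<subseteq> S" "finite A" by auto
        have "norm (f w) \<le> (\<Prod>b\<in>a ` A. norm (Moebius_function 0 b w))"
        proof (rule norm_le_Blaschke_product[OF _ holf lef _ w])
          fix b assume "b \<in> a ` A"
          then show "norm b < 1 \<and> f b = 0"
            using A S a_bounds a_norm by (auto simp: f_def Ta subset_iff)
        qed (use A in auto)
        also have "\<dots> = (\<Prod>n\<in>A. norm (Moebius_function 0 (a n) w))"
          by (simp add: prod.reindex[OF inj_a])
        finally have "(norm (f w))\<^sup>2 \<le> (\<Prod>n\<in>A. norm (Moebius_function 0 (a n) w))\<^sup>2"
          by (rule power_mono) auto
        also have "\<dots> = (\<Prod>n\<in>A. (norm (Moebius_function 0 (a n) w))\<^sup>2)"
          by (simp add: prod_power_distrib)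
        also have "\<dots> \<le> (\<Prod>n\<in>A. exp (- d * (1 / real n)))"
          using A factor by (intro prod_mono) auto
        also have "\<dots> = exp (- d * (\<Sum>n\<in>A. 1 / real n))"
          using A by (simp add: exp_sum sum_distrib_left)
        finally have "ln ((norm (f w))\<^sup>2) \<le> - d * (\<Sum>n\<in>A. 1 / real n)"
          using pos by (metis ln_exp ln_mono zero_less_power)
        then show "(\<Sum>n\<in>A. 1 / real n) \<le> K"
          using d by (simp add: K_def field_simps)
      qed
    qed auto
    then show False using div by contradiction
  qed
  then show ?thesis using C by (simp add: f_def Tw)
qed

section \<open>Radial Mellin transforms on the disk\<close>

lemma space_disk_measure [simp]: "space disk_measure = unit_disk"
  by (simp add: disk_measure_def)

lemma finite_measure_disk_measure: "finite_measure disk_measure"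
proof
  have "emeasure disk_measure unit_disk = ennreal (1 / pi) * emeasure lebesgue unit_disk"
    by (simp add: disk_measure_def emeasure_density_const emeasure_restrict_space)
  also have "\<dots> < \<infinity>"
    using emeasure_bounded_finite[of unit_disk]
    by (auto simp: ennreal_mult_less_top less_top)
  finally show "emeasure disk_measure (space disk_measure) \<noteq> \<infinity>" by simp
qed

interpretation disk: finite_measure disk_measure
  by (rule finite_measure_disk_measure)

lemma AE_disk_measure: "(AE z in disk_measure. P z) \<longleftrightarrow> (AE z in lebesgue. z \<in> unit_disk \<longrightarrow> P z)"
  unfolding disk_measure_def
  by (subst AE_density) (auto simp: AE_restrict_space_iff)

lemma measurable_ident_disk_measure [measurable]: "(\<lambda>z. z) \<in> disk_measure \<rightarrow>\<^sub>M borel"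
  by (simp add: disk_measure_def measurable_restrict_space1 measurable_completion)

lemma integrable_disk_bounded:
  fixes f :: "complex \<Rightarrow> 'a::{banach, second_countable_topology}"
  assumes "f \<in> borel_measurable disk_measure" and "\<And>z. z \<in> unit_disk \<Longrightarrow> norm (f z) \<le> B"
  shows "integrable disk_measure f"
  using assms by (intro disk.integrable_const_bound[of _ B]) auto

lemma AE_disk_measure_ne_0: "AE z in disk_measure. z \<noteq> 0"
proof -
  have "AE z in lebesgue. z \<noteq> (0::complex)"
    by (rule AE_completion) (rule AE_lborel_singleton)
  then show ?thesis by (auto simp: AE_disk_measure)
qed

text \<open>For radial \<open>f\<close>, substituting t = |z|^2 turns this into the integral of f
  t^s dt over (0, 1), that is, the Mellin transform in t at s + 1.\<close>

definition radial_mellin :: "(complex \<Rightarrow> complex) \<Rightarrow> complex \<Rightarrow> complex" where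
  "radial_mellin f s = (LINT z|disk_measure. f z * of_real ((cmod z)\<^sup>2) powr s)"

lemma norm_of_real_powr: "t \<ge> 0 \<Longrightarrow> norm (of_real t powr s) = t powr Re s"
  by (cases "t = 0") (auto simp: norm_powr_real powr_def)

lemma norm_cmod_powr_le_1:
  assumes "z \<in> unit_disk" "Re s \<ge> 0"
  shows "norm (of_real ((cmod z)\<^sup>2) powr s) \<le> 1"
  using assms by (subst norm_of_real_powr) (auto simp: powr_le1 power_le_one)

lemma measurable_cmod_powr [measurable]:
  "(\<lambda>z. complex_of_real ((cmod z)\<^sup>2) powr s) \<in> borel_measurable disk_measure"
proof -
  have "complex_of_real ((cmod z)\<^sup>2) powr s
      = (if z = 0 then 0 else exp (s * of_real (ln ((cmod z)\<^sup>2))))" for z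
    unfolding powr_def by (auto simp: Ln_of_real simp del: of_real_power)
  then show ?thesis by simp
qed

text \<open>At the origin \<open>0 powr 0\<close> is 0 whereas \<open>0 ^ 0\<close> is 1, so
  \<open>n > 0\<close> makes the two integrands agree at every point.\<close>

lemma radial_mellin_of_nat:
  assumes "n > 0"
  shows "radial_mellin f (of_nat n) = (LINT z|disk_measure. f z * of_real (cmod z) ^ (2 * n))"
  unfolding radial_mellin_def
proof (rule Bochner_Integration.integral_cong[OF refl])
  fix z
  show "f z * of_real ((cmod z)\<^sup>2) powr of_nat n = f z * of_real (cmod z) ^ (2 * n)"
    using assms by (cases "z = 0") (auto simp: powr_nat' power_mult)
qed

context
  fixes f :: "complex \<Rightarrow> complex" and B :: real
  assumes meas [measurable]: "f \<in> borel_measurable disk_measure"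
    and bd: "\<And>z. z \<in> unit_disk \<Longrightarrow> norm (f z) \<le> B"
begin

lemma norm_mellin_integrand_le:
  assumes "z \<in> unit_disk" "Re s \<ge> 0"
  shows "norm (f z * of_real ((cmod z)\<^sup>2) powr s) \<le> B"
proof -
  have "norm (f z * of_real ((cmod z)\<^sup>2) powr s) \<le> B * 1"
    unfolding norm_mult using assms bd[OF assms(1)] norm_ge_zero[of "f z"]
    by (intro mult_mono norm_cmod_powr_le_1 norm_ge_zero) linarith+
  then show ?thesis by simp
qed

lemma integrable_mellin_integrand:
  assumes "Re s \<ge> 0"
  shows "integrable disk_measure (\<lambda>z. f z * of_real ((cmod z)\<^sup>2) powr s)"
  by (rule integrable_disk_bounded[of _ B]) (use norm_mellin_integrand_le assms in auto)

lemma norm_radial_mellin_le: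
  assumes "Re s \<ge> 0"
  shows "norm (radial_mellin f s) \<le> B * measure disk_measure unit_disk"
proof -
  have "norm (radial_mellin f s) \<le> (LINT z|disk_measure. norm (f z * of_real ((cmod z)\<^sup>2) powr s))"
    unfolding radial_mellin_def by (rule integral_norm_bound)
  also have "\<dots> \<le> (LINT z|disk_measure. B)"
    using integrable_mellin_integrand[OF assms] norm_mellin_integrand_le[OF _ assms]
    by (intro integral_mono) auto
  finally show ?thesis by (simp add: mult.commute)
qed

text \<open>Differentiation under the integral sign by dominated convergence along sequences. The
  mean value inequality on a convex half-plane turns a uniform bound on the derivative of the kernel
  into one on its difference quotients.\<close>

lemma has_field_derivative_radial_mellin:
  assumes s: "Re s > 0"
  shows "(radial_mellin f has_field_derivative
    (LINT z|disk_measure. f z * (of_real (ln ((cmod z)\<^sup>2)) * of_real ((cmod z)\<^sup>2) powr s))) (at s)"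
proof -
  define k :: "complex \<Rightarrow> complex \<Rightarrow> complex" where "k = (\<lambda>z s. of_real ((cmod z)\<^sup>2) powr s)"
  define k' :: "complex \<Rightarrow> complex \<Rightarrow> complex" where "k' = (\<lambda>z s. of_real (ln ((cmod z)\<^sup>2)) * k z s)"
  \<comment> \<open>Keeps the parameters near \<open>s\<close> away from the imaginary axis, where
    the logarithm in the differentiated kernel is no longer controlled.\<close>
  define d where "d = Re s / 2"
  have d: "d > 0" using s by (simp add: d_def)
  have km [measurable]: "(\<lambda>z. k z s) \<in> borel_measurable disk_measure" for s
    unfolding k_def by measurable
  have k'm [measurable]: "(\<lambda>z. k' z s) \<in> borel_measurable disk_measure" for s
    unfolding k'_def by measurable
  \<comment> \<open>At \<open>z = 0\<close> both kernels are identically 0, because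
    \<open>0 powr u\<close> is 0.\<close>
  have der: "(k z has_field_derivative k' z u) (at u)" for z u
  proof (cases "z = 0")
    case True
    then show ?thesis by (simp add: k_def k'_def powr_def)
  next
    case False
    then show ?thesis
      unfolding k_def k'_def
      by (auto intro!: derivative_eq_intros simp: powr_def Ln_of_real simp del: of_real_power)
  qed
  have k'_bd: "norm (k' z u) \<le> 1 / d" if z: "z \<in> unit_disk" and u: "Re u > d" for z u
  proof (cases "z = 0")
    case True
    then show ?thesis using d by (simp add: k'_def k_def)
  next
    case False
    define t where "t = (cmod z)\<^sup>2"
    have t: "0 < t" "t \<le> 1" using False z by (auto simp: t_def power_le_one)
    have "norm (k' z u) = - ln t * t powr Re u"
      using t by (simp add: k'_def k_def norm_mult t_def[symmetric] norm_of_real_powr del: of_real_power)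
    also have "\<dots> \<le> - ln t * t powr d"
      using t u by (intro mult_left_mono powr_mono') auto
    \<comment> \<open>This is x \<le> exp x at x = - d ln t; multiplied by t^d it leaves the
      constant 1 / d.\<close>
    also have "- ln t \<le> t powr (- d) / d"
    proof -
      have "d * (- ln t) \<le> exp (d * (- ln t))"
        using exp_ge_add_one_self[of "d * (- ln t)"] by linarith
      then show ?thesis using d t by (simp add: powr_def field_simps)
    qed
    then have "- ln t * t powr d \<le> t powr (- d) / d * t powr d"
      by (intro mult_right_mono) auto
    also have "\<dots> = 1 / d" using t by (simp add: powr_minus)
    finally show ?thesis .
  qed
  have quot_bd: "norm ((k z u - k z s) / (u - s)) \<le> 1 / d"
    if z: "z \<in> unit_disk" and u: "Re u > d" for z u
  proof -
    have "norm (k z u - k z s) \<le> 1 / d * norm (u - s)"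
    proof (rule field_differentiable_bound[of "{u. Re u > d}" "k z" "k' z"])
      show "convex {u. d < Re u}" by (rule convex_halfspace_Re_gt)
    qed (use der k'_bd z u s d in \<open>auto simp: d_def intro: has_field_derivative_at_within\<close>)
    then show ?thesis using d by (cases "u = s") (auto simp: norm_divide divide_simps)
  qed
  have mellin: "radial_mellin f u = (LINT z|disk_measure. f z * k z u)" for u
    by (simp add: radial_mellin_def k_def)
  have int: "integrable disk_measure (\<lambda>z. f z * k z u)" if "Re u > d" for u
    using integrable_mellin_integrand[of u] that d by (simp add: k_def)
  have "((\<lambda>u. (radial_mellin f u - radial_mellin f s) / (u - s))
          \<longlongrightarrow> (LINT z|disk_measure. f z * k' z s)) (at s)"
    unfolding tendsto_at_iff_sequentially
  proof (intro allI impI)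
    fix X assume X: "\<forall>i. X i \<in> UNIV - {s}" "X \<longlonglongrightarrow> s"
    have "eventually (\<lambda>u. Re u > d) (nhds s)"
    proof (rule eventually_nhds_in_open[where s = "{u. Re u > d}", simplified])
      show "open {u. d < Re u}" by (rule open_halfspace_Re_gt)
      show "Re s > d" using s by (simp add: d_def)
    qed
    with X(2) have "eventually (\<lambda>i. Re (X i) > d) sequentially"
      using filterlim_iff by blast
    then obtain N where N: "\<And>i. i \<ge> N \<Longrightarrow> Re (X i) > d"
      by (auto simp: eventually_sequentially)
    \<comment> \<open>The bound on difference quotients holds only once the sequence has entered the
      half-plane, so dominated convergence is applied to a tail.\<close>
    define Y where "Y = (\<lambda>i. X (i + N))"
    have Y: "Re (Y i) > d" "Y i \<noteq> s" for i using N X by (auto simp: Y_def)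
    have Ylim: "Y \<longlonglongrightarrow> s" unfolding Y_def by (rule LIMSEQ_ignore_initial_segment[OF X(2)])
    have L: "(\<lambda>i. LINT z|disk_measure. f z * ((k z (Y i) - k z s) / (Y i - s)))
        \<longlonglongrightarrow> (LINT z|disk_measure. f z * k' z s)"
    proof (rule integral_dominated_convergence[where w = "\<lambda>_. B * (1 / d)"])
      show "AE z in disk_measure. (\<lambda>i. f z * ((k z (Y i) - k z s) / (Y i - s))) \<longlonglongrightarrow> f z * k' z s"
      proof (rule AE_I2)
        fix z
        have "((\<lambda>u. (k z u - k z s) / (u - s)) \<longlongrightarrow> k' z s) (at s)"
          using der[of z s] by (simp add: has_field_derivative_iff)
        then have "((\<lambda>u. (k z u - k z s) / (u - s)) \<circ> Y) \<longlonglongrightarrow> k' z s"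
          unfolding tendsto_at_iff_sequentially using Y Ylim by blast
        then show "(\<lambda>i. f z * ((k z (Y i) - k z s) / (Y i - s))) \<longlonglongrightarrow> f z * k' z s"
          by (intro tendsto_mult tendsto_const) (simp add: o_def)
      qed
      show "AE z in disk_measure. norm (f z * ((k z (Y i) - k z s) / (Y i - s))) \<le> B * (1 / d)" for i
      proof (rule AE_I2)
        fix z assume "z \<in> space disk_measure"
        then have z: "z \<in> unit_disk" by simp
        then show "norm (f z * ((k z (Y i) - k z s) / (Y i - s))) \<le> B * (1 / d)"
          unfolding norm_mult using bd[OF z] norm_ge_zero[of "f z"] quot_bd[OF z Y(1)[of i]]
          by (intro mult_mono norm_ge_zero) linarith+
      qed
    qed auto
    have E: "(LINT z|disk_measure. f z * ((k z (Y i) - k z s) / (Y i - s)))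
        = (radial_mellin f (Y i) - radial_mellin f s) / (Y i - s)" for i
    proof -
      have "Re s > d" using s by (simp add: d_def)
      then have "(LINT z|disk_measure. (f z * k z (Y i) - f z * k z s) / (Y i - s))
          = (radial_mellin f (Y i) - radial_mellin f s) / (Y i - s)"
        by (simp add: mellin int Y(1))
      then show ?thesis by (simp add: right_diff_distrib)
    qed
    have "(\<lambda>i. ((\<lambda>u. (radial_mellin f u - radial_mellin f s) / (u - s)) \<circ> X) (i + N))
        \<longlonglongrightarrow> (LINT z|disk_measure. f z * k' z s)"
      using L unfolding E by (simp add: Y_def)
    then show "((\<lambda>u. (radial_mellin f u - radial_mellin f s) / (u - s)) \<circ> X)
        \<longlonglongrightarrow> (LINT z|disk_measure. f z * k' z s)"
      by (rule LIMSEQ_offset)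
  qed
  then show ?thesis
    by (simp add: has_field_derivative_iff k'_def k_def)
qed

lemma holomorphic_radial_mellin: "radial_mellin f holomorphic_on {s. Re s > 0}"
  using has_field_derivative_radial_mellin
  by (auto simp: holomorphic_on_def field_differentiable_def intro: has_field_derivative_at_within)

end

section \<open>Rotation invariance\<close>

text \<open>The library knows that rotations preserve the measure only on vector types, so the result is
  transported from \<open>real^2\<close> to the complex plane.\<close>
lemma lborel_distr_orthogonal_transformation:
  fixes f :: "real^'n::{finite,wellorder} \<Rightarrow> real^'n::_"
  assumes f: "orthogonal_transformation f"
  shows "distr lborel borel f = lborel"
proof (rule lborel_eqI[symmetric])
  fix l u :: "(real, 'n) vec" assume le: "\<And>b. b \<in> Basis \<Longrightarrow> l \<bullet> b \<le> u \<bullet> b"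
  define g where "g = inv f"
  have g: "orthogonal_transformation g" unfolding g_def by (rule orthogonal_transformation_inv[OF f])
  have bij: "bij f" by (rule orthogonal_transformation_bij[OF f])
  have lin: "linear f" using f by (rule orthogonal_transformation_linear)
  have [measurable]: "f \<in> borel \<rightarrow>\<^sub>M borel"
    using lin linear_continuous_on linear_conv_bounded_linear by (intro borel_measurable_continuous_onI) blast
  have vim: "f -` box l u = g ` box l u"
    unfolding g_def by (rule bij_vimage_eq_inv_image[OF bij])
  have meas_vim: "f -` box l u \<in> sets borel"
    using measurable_sets_borel[of f borel "box l u"] by simp
  have lm: "box l u \<in> lmeasurable" by simp
  have "emeasure (distr lborel borel f) (box l u) = emeasure lborel (f -` box l u)"
    by (simp add: emeasure_distr)
  also have "\<dots> = emeasure lebesgue (g ` box l u)"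
    unfolding vim[symmetric] using meas_vim by simp
  also have "\<dots> = ennreal (measure lebesgue (g ` box l u))"
    using measurable_orthogonal_image[OF g lm] by (simp add: emeasure_eq_measure2 fmeasurableD)
  also have "\<dots> = ennreal (measure lebesgue (box l u))"
    by (simp only: measure_orthogonal_image[OF g lm])
  also have "\<dots> = emeasure lborel (box l u)"
    using lm by (simp add: emeasure_eq_measure2)
  also have "\<dots> = (\<Prod>b\<in>Basis. (u - l) \<bullet> b)"
    using le by (rule emeasure_lborel_box)
  finally show "emeasure (distr lborel borel f) (box l u) = (\<Prod>b\<in>Basis. (u - l) \<bullet> b)" .
qed simp

definition complex_of_vec :: "real^2 \<Rightarrow> complex" where
  "complex_of_vec x = Complex (vec_nth x 1) (vec_nth x 2)"

definition vec_of_complex :: "complex \<Rightarrow> real^2" where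
  "vec_of_complex z = vector [Re z, Im z]"

lemma complex_of_vec_of_complex [simp]: "complex_of_vec (vec_of_complex z) = z"
  by (simp add: complex_of_vec_def vec_of_complex_def)

lemma vec_of_complex_of_vec [simp]: "vec_of_complex (complex_of_vec x) = x"
  by (simp add: complex_of_vec_def vec_of_complex_def vec_eq_iff forall_2)

lemma linear_complex_of_vec: "linear complex_of_vec"
  by (rule linearI) (simp_all add: complex_of_vec_def complex_eq_iff)

lemma linear_vec_of_complex: "linear vec_of_complex"
  by (rule linearI) (simp_all add: vec_of_complex_def vec_eq_iff forall_2)

lemma norm_complex_of_vec: "norm (complex_of_vec x) = norm x"
  by (simp add: complex_of_vec_def norm_vec_def L2_set_def sum_2 cmod_def)

lemma measurable_complex_of_vec [measurable]: "complex_of_vec \<in> borel \<rightarrow>\<^sub>M borel"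
  using linear_complex_of_vec linear_continuous_on linear_conv_bounded_linear
  by (intro borel_measurable_continuous_onI) blast

text \<open>Boxes pull back to boxes with the same side lengths, and Lebesgue measure is determined
  by its values on boxes.\<close>

lemma lborel_distr_complex_of_vec: "distr lborel borel complex_of_vec = lborel"
proof (rule lborel_eqI[symmetric])
  fix l u :: complex assume le: "\<And>b. b \<in> Basis \<Longrightarrow> l \<bullet> b \<le> u \<bullet> b"
  have le': "Re l \<le> Re u" "Im l \<le> Im u"
    using le[of 1] le[of \<i>] by (auto simp: Basis_complex_def inner_complex_def)
  have vim: "complex_of_vec -` box l u = box (vec_of_complex l) (vec_of_complex u)"
    by (auto simp: complex_of_vec_def vec_of_complex_def in_box_complex_iff mem_box_cart forall_2)
  have B: "(Basis :: (real^2) set) = {axis 1 1, axis 2 1}"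
    by (auto simp: Basis_vec_def UNIV_2)
  have ne: "axis 1 1 \<noteq> (axis 2 1 :: real^2)" by (simp add: axis_eq_axis)
  have "emeasure (distr lborel borel complex_of_vec) (box l u)
      = emeasure lborel (box (vec_of_complex l) (vec_of_complex u))"
    by (simp add: emeasure_distr vim)
  also have "\<dots> = (\<Prod>b\<in>Basis. (vec_of_complex u - vec_of_complex l) \<bullet> b)"
    by (rule emeasure_lborel_box) (use le' in \<open>auto simp: B vec_of_complex_def inner_axis\<close>)
  also have "(\<Prod>b\<in>Basis. (vec_of_complex u - vec_of_complex l) \<bullet> b) = (\<Prod>b\<in>Basis. (u - l) \<bullet> b)"
    using ne by (simp add: B vec_of_complex_def inner_axis Basis_complex_def inner_complex_def)
  finally show "emeasure (distr lborel borel complex_of_vec) (box l u) = (\<Prod>b\<in>Basis. (u - l) \<bullet> b)" .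
qed simp

text \<open>Conjugated to \<open>real^2\<close>, multiplication by a unimodular number is linear and
  norm preserving, hence orthogonal.\<close>

lemma lborel_distr_complex_rotation:
  assumes c: "norm c = 1"
  shows "distr lborel borel ((*) c) = (lborel :: complex measure)"
proof -
  define R where "R = vec_of_complex \<circ> (*) c \<circ> complex_of_vec"
  have lin: "linear R" unfolding R_def
    by (intro linear_compose linear_complex_of_vec linear_vec_of_complex)
      (auto intro!: linearI simp: algebra_simps)
  moreover have "norm (R x) = norm x" for x
    using c by (simp add: R_def norm_mult norm_complex_of_vec flip: norm_complex_of_vec[of "vec_of_complex _"])
  ultimately have R: "orthogonal_transformation R" by (simp add: orthogonal_transformation)
  have [measurable]: "R \<in> borel \<rightarrow>\<^sub>M borel"
    using lin linear_continuous_on linear_conv_bounded_linear by (intro borel_measurable_continuous_onI) blast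
  have "distr lborel borel ((*) c) = distr (distr lborel borel complex_of_vec) borel ((*) c)"
    by (simp add: lborel_distr_complex_of_vec)
  also have "\<dots> = distr lborel borel ((*) c \<circ> complex_of_vec)"
    by (rule distr_distr) auto
  also have "(*) c \<circ> complex_of_vec = complex_of_vec \<circ> R"
    by (auto simp: R_def)
  also have "distr lborel borel (complex_of_vec \<circ> R) = distr (distr lborel borel R) borel complex_of_vec"
    by (rule distr_distr[symmetric]) auto
  also have "\<dots> = lborel"
    by (simp add: lborel_distr_orthogonal_transformation[OF R] lborel_distr_complex_of_vec)
  finally show ?thesis .
qed

text \<open>Measurability for the completed measure requires null sets to pull back to null sets.
  This is why the Borel image measure is computed first and then used for both claims.\<close>

lemma
  fixes c :: complex
  assumes c: "norm c = 1"
  shows lebesgue_measurable_complex_rotation: "(*) c \<in> lebesgue \<rightarrow>\<^sub>M lebesgue"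
    and lebesgue_distr_complex_rotation: "distr lebesgue lebesgue ((*) c) = lebesgue"
proof -
  have m: "(*) c \<in> lborel \<rightarrow>\<^sub>M lborel" by simp
  have m': "(*) c \<in> lebesgue \<rightarrow>\<^sub>M lborel" by (rule measurable_completion[OF m])
  have eq: "distr lebesgue lborel ((*) c) = lborel"
    using lborel_distr_complex_rotation[OF c] by (simp add: distr_completion m cong: distr_cong)
  show "(*) c \<in> lebesgue \<rightarrow>\<^sub>M lebesgue"
    by (rule completion.measurable_completion2[OF m']) (simp add: eq)
  show "distr lebesgue lebesgue ((*) c) = lebesgue"
    using completion.completion_distr_eq[OF m'] by (simp add: eq)
qed

lemma integral_disk_measure:
  fixes f :: "complex \<Rightarrow> complex"
  assumes [measurable]: "f \<in> borel_measurable disk_measure"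
  shows "integral\<^sup>L disk_measure f = (LINT z|lebesgue. indicator unit_disk z *\<^sub>R ((1 / pi) *\<^sub>R f z))"
proof -
  have "f \<in> borel_measurable (lebesgue_on unit_disk)"
    using assms by (simp add: disk_measure_def)
  then have "integral\<^sup>L disk_measure f = (LINT z|lebesgue_on unit_disk. (1 / pi) *\<^sub>R f z)"
    unfolding disk_measure_def by (intro integral_density) auto
  also have "\<dots> = (LINT z|lebesgue. indicator unit_disk z *\<^sub>R ((1 / pi) *\<^sub>R f z))"
    by (rule integral_restrict_space) auto
  finally show ?thesis .
qed

lemma measurable_disk_rotation [measurable]:
  assumes c: "norm c = 1"
  shows "(*) c \<in> disk_measure \<rightarrow>\<^sub>M disk_measure"
proof -
  have "(*) c \<in> lebesgue_on unit_disk \<rightarrow>\<^sub>M lebesgue_on unit_disk"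
    by (rule measurable_restrict_space3[OF lebesgue_measurable_complex_rotation[OF c]])
      (auto simp: norm_mult c)
  then show ?thesis by (simp add: disk_measure_def cong: measurable_cong_sets)
qed

lemma integral_disk_rotation:
  fixes f :: "complex \<Rightarrow> complex"
  assumes c: "norm c = 1" and f: "f \<in> borel_measurable disk_measure"
  shows "(LINT z|disk_measure. f (c * z)) = integral\<^sup>L disk_measure f"
proof -
  define g where "g = (\<lambda>z. indicator unit_disk z *\<^sub>R ((1 / pi) *\<^sub>R f z))"
  have fm: "f \<in> borel_measurable (lebesgue_on unit_disk)"
    using f by (simp add: disk_measure_def)
  have "(\<lambda>z. indicator unit_disk z *\<^sub>R f z) \<in> borel_measurable lebesgue"
    using borel_measurable_restrict_space_iff[of unit_disk lebesgue f] fm by simp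
  then have "(\<lambda>z. (1 / pi) *\<^sub>R (indicator unit_disk z *\<^sub>R f z)) \<in> borel_measurable lebesgue"
    by (rule borel_measurable_scaleR[OF borel_measurable_const])
  then have gm: "g \<in> borel_measurable lebesgue"
    by (simp add: g_def mult.commute)
  have fc: "(\<lambda>z. f (c * z)) \<in> borel_measurable disk_measure"
    using measurable_compose[OF measurable_disk_rotation[OF c] f] by simp
  have "(LINT z|disk_measure. f (c * z)) = (LINT z|lebesgue. g (c * z))"
    unfolding integral_disk_measure[OF fc] g_def
    by (intro Bochner_Integration.integral_cong refl) (auto simp: indicator_def norm_mult c)
  also have "\<dots> = integral\<^sup>L (distr lebesgue lebesgue ((*) c)) g"
    by (rule integral_distr[symmetric, OF lebesgue_measurable_complex_rotation[OF c] gm])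
  also have "\<dots> = integral\<^sup>L disk_measure f"
    unfolding lebesgue_distr_complex_rotation[OF c] integral_disk_measure[OF f] g_def ..
  finally show ?thesis .
qed

text \<open>Rotating by \<open>pi / m\<close> replaces \<open>f\<close> by its negative without
  changing the integral. Homogeneity is asked for only almost everywhere because angular factors
  violate it at the origin.\<close>

lemma integral_disk_homogeneous_eq_0:
  fixes f :: "complex \<Rightarrow> complex"
  assumes f: "f \<in> borel_measurable disk_measure" and "m \<noteq> 0"
    and hom: "\<And>t. AE z in disk_measure. f (cis t * z) = cis (of_int m * t) * f z"
  shows "integral\<^sup>L disk_measure f = 0"
proof -
  define t where "t = pi / of_int m"
  have cm: "cis (of_int m * t) = -1" using \<open>m \<noteq> 0\<close> by (simp add: t_def)
  have fc: "(\<lambda>z. f (cis t * z)) \<in> borel_measurable disk_measure"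
    using measurable_compose[OF measurable_disk_rotation f, of "cis t"] by simp
  have "integral\<^sup>L disk_measure f = (LINT z|disk_measure. f (cis t * z))"
    by (rule integral_disk_rotation[symmetric]) (use f in auto)
  also have "\<dots> = (LINT z|disk_measure. - f z)"
    by (rule integral_cong_AE) (use f fc hom[of t] cm in auto)
  finally show ?thesis by simp
qed

section \<open>Harmonic functions on the disk\<close>

lemma has_real_derivative_Complex1:
  fixes f :: "complex \<Rightarrow> real"
  assumes "(f has_derivative (\<lambda>h. Re h *\<^sub>R a + Im h *\<^sub>R b)) (at (Complex s t))"
  shows "((\<lambda>s. f (Complex s t)) has_real_derivative a) (at s)"
proof -
  have "((\<lambda>s. Complex s t) has_derivative (\<lambda>h. Complex h 0)) (at s)"
    unfolding Complex_eq by (auto intro!: derivative_eq_intros)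
  from has_derivative_compose[OF this assms] show ?thesis
    unfolding has_field_derivative_def by (rule has_derivative_eq_rhs) (simp add: fun_eq_iff)
qed

lemma has_real_derivative_Complex2:
  fixes f :: "complex \<Rightarrow> real"
  assumes "(f has_derivative (\<lambda>h. Re h *\<^sub>R a + Im h *\<^sub>R b)) (at (Complex s t))"
  shows "((\<lambda>t. f (Complex s t)) has_real_derivative b) (at t)"
proof -
  have "((\<lambda>t. Complex s t) has_derivative (\<lambda>h. Complex 0 h)) (at t)"
    unfolding Complex_eq by (auto intro!: derivative_eq_intros)
  from has_derivative_compose[OF this assms] show ?thesis
    unfolding has_field_derivative_def by (rule has_derivative_eq_rhs) (simp add: fun_eq_iff)
qed

text \<open>The second difference of \<open>u\<close> over a small square with corner
  \<open>z0\<close> is h^2 times a value of \<open>uxy\<close> and, with the mean value theorems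
  applied in the other order, h^2 times a value of \<open>uyx\<close>. Continuity then compares both
  with their values at \<open>z0\<close>. Symmetry is not part of \<open>harmonic_on\<close>, which
  names the two mixed derivatives separately.\<close>

lemma mixed_partial_derivatives_eq_real:
  fixes u ux uy uxx uxy uyx uyy :: "complex \<Rightarrow> real"
  assumes "open S" and z0: "z0 \<in> S"
    and du: "\<And>z. z \<in> S \<Longrightarrow> (u has_derivative (\<lambda>h. Re h *\<^sub>R ux z + Im h *\<^sub>R uy z)) (at z)"
    and dux: "\<And>z. z \<in> S \<Longrightarrow> (ux has_derivative (\<lambda>h. Re h *\<^sub>R uxx z + Im h *\<^sub>R uxy z)) (at z)"
    and duy: "\<And>z. z \<in> S \<Longrightarrow> (uy has_derivative (\<lambda>h. Re h *\<^sub>R uyx z + Im h *\<^sub>R uyy z)) (at z)"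
    and cont: "continuous_on S uxy" "continuous_on S uyx"
  shows "uxy z0 = uyx z0"
proof -
  have close: "\<bar>uxy z0 - uyx z0\<bar> < 2 * e" if e: "e > 0" for e :: real
  proof -
    obtain r where r: "r > 0" "ball z0 r \<subseteq> S"
      using \<open>open S\<close> z0 by (auto simp: open_contains_ball)
    obtain d1 where d1: "d1 > 0" "\<And>z. z \<in> S \<Longrightarrow> dist z z0 < d1 \<Longrightarrow> \<bar>uxy z - uxy z0\<bar> < e"
      using cont(1) z0 e unfolding continuous_on_iff dist_real_def by blast
    obtain d2 where d2: "d2 > 0" "\<And>z. z \<in> S \<Longrightarrow> dist z z0 < d2 \<Longrightarrow> \<bar>uyx z - uyx z0\<bar> < e"
      using cont(2) z0 e unfolding continuous_on_iff dist_real_def by blast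
    \<comment> \<open>Points of the square are at distance at most 2 h from \<open>z0\<close>; the
      divisor 3 keeps them strictly inside all three radii.\<close>
    define h where "h = min r (min d1 d2) / 3"
    have h: "h > 0" "3 * h \<le> r" "3 * h \<le> d1" "3 * h \<le> d2" using r d1 d2 by (auto simp: h_def)
    define x y where "x = Re z0" and "y = Im z0"
    have near: "dist (Complex s t) z0 < 3 * h" if "x \<le> s" "s \<le> x + h" "y \<le> t" "t \<le> y + h" for s t
    proof -
      have "dist (Complex s t) z0 \<le> \<bar>s - x\<bar> + \<bar>t - y\<bar>"
        using cmod_le[of "Complex s t - z0"] by (simp add: dist_norm x_def y_def)
      then show ?thesis using that h by linarith
    qed
    have inS: "Complex s t \<in> S" if "x \<le> s" "s \<le> x + h" "y \<le> t" "t \<le> y + h" for s t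
      using near[OF that] h r by (auto simp: dist_commute)
    define \<Delta> where "\<Delta> = u (Complex (x + h) (y + h)) - u (Complex (x + h) y)
        - u (Complex x (y + h)) + u (Complex x y)"
    have "\<exists>s>x. s < x + h \<and> (u (Complex (x + h) (y + h)) - u (Complex (x + h) y))
        - (u (Complex x (y + h)) - u (Complex x y))
        = (x + h - x) * (ux (Complex s (y + h)) - ux (Complex s y))"
      by (rule MVT2) (use h in \<open>auto intro!: DERIV_diff has_real_derivative_Complex1 du inS\<close>)
    then obtain s where s: "x < s" "s < x + h"
      "\<Delta> = h * (ux (Complex s (y + h)) - ux (Complex s y))" by (auto simp: \<Delta>_def)
    have "\<exists>t>y. t < y + h \<and> ux (Complex s (y + h)) - ux (Complex s y) = (y + h - y) * uxy (Complex s t)"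
      by (rule MVT2) (use h s in \<open>auto intro!: has_real_derivative_Complex2 dux inS\<close>)
    then obtain t where t: "y < t" "t < y + h" "\<Delta> = h * (h * uxy (Complex s t))" using s by auto
    have "\<exists>t>y. t < y + h \<and> (u (Complex (x + h) (y + h)) - u (Complex x (y + h)))
        - (u (Complex (x + h) y) - u (Complex x y))
        = (y + h - y) * (uy (Complex (x + h) t) - uy (Complex x t))"
      by (rule MVT2) (use h in \<open>auto intro!: DERIV_diff has_real_derivative_Complex2 du inS\<close>)
    then obtain t' where t': "y < t'" "t' < y + h"
      "\<Delta> = h * (uy (Complex (x + h) t') - uy (Complex x t'))" by (auto simp: \<Delta>_def)
    have "\<exists>s>x. s < x + h \<and> uy (Complex (x + h) t') - uy (Complex x t') = (x + h - x) * uyx (Complex s t')"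
      by (rule MVT2) (use h t' in \<open>auto intro!: has_real_derivative_Complex1 duy inS\<close>)
    then obtain s' where s': "x < s'" "s' < x + h" "\<Delta> = h * (h * uyx (Complex s' t'))" using t' by auto
    have "uxy (Complex s t) = uyx (Complex s' t')"
      using t(3) s'(3) h by simp
    moreover have "\<bar>uxy (Complex s t) - uxy z0\<bar> < e"
      using s t h near[of s t] by (intro d1 inS) auto
    moreover have "\<bar>uyx (Complex s' t') - uyx z0\<bar> < e"
      using s' t' h near[of s' t'] by (intro d2 inS) auto
    ultimately show ?thesis by linarith
  qed
  show ?thesis
  proof (rule ccontr)
    assume "uxy z0 \<noteq> uyx z0"
    then have "\<bar>uxy z0 - uyx z0\<bar> > 0" by simp
    from close[of "\<bar>uxy z0 - uyx z0\<bar> / 2"] this show False by simp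
  qed
qed

text \<open>The mean value theorem with equality is a real-valued statement, so real and imaginary
  parts are treated separately.\<close>

lemma mixed_partial_derivatives_eq:
  fixes u ux uy uxx uxy uyx uyy :: "complex \<Rightarrow> complex"
  assumes "open S" and z0: "z0 \<in> S"
    and du: "\<And>z. z \<in> S \<Longrightarrow> (u has_derivative (\<lambda>h. Re h *\<^sub>R ux z + Im h *\<^sub>R uy z)) (at z)"
    and dux: "\<And>z. z \<in> S \<Longrightarrow> (ux has_derivative (\<lambda>h. Re h *\<^sub>R uxx z + Im h *\<^sub>R uxy z)) (at z)"
    and duy: "\<And>z. z \<in> S \<Longrightarrow> (uy has_derivative (\<lambda>h. Re h *\<^sub>R uyx z + Im h *\<^sub>R uyy z)) (at z)"
    and cont: "continuous_on S uxy" "continuous_on S uyx"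
  shows "uxy z0 = uyx z0"
proof (rule complex_eqI)
  show "Re (uxy z0) = Re (uyx z0)"
  proof (rule mixed_partial_derivatives_eq_real[OF \<open>open S\<close> z0])
    fix z assume z: "z \<in> S"
    show "((\<lambda>z. Re (u z)) has_derivative (\<lambda>h. Re h *\<^sub>R Re (ux z) + Im h *\<^sub>R Re (uy z))) (at z)"
      using has_derivative_Re[OF du[OF z]] by simp
    show "((\<lambda>z. Re (ux z)) has_derivative (\<lambda>h. Re h *\<^sub>R Re (uxx z) + Im h *\<^sub>R Re (uxy z))) (at z)"
      using has_derivative_Re[OF dux[OF z]] by simp
    show "((\<lambda>z. Re (uy z)) has_derivative (\<lambda>h. Re h *\<^sub>R Re (uyx z) + Im h *\<^sub>R Re (uyy z))) (at z)"
      using has_derivative_Re[OF duy[OF z]] by simp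
  qed (auto intro!: continuous_intros cont)
  show "Im (uxy z0) = Im (uyx z0)"
  proof (rule mixed_partial_derivatives_eq_real[OF \<open>open S\<close> z0])
    fix z assume z: "z \<in> S"
    show "((\<lambda>z. Im (u z)) has_derivative (\<lambda>h. Re h *\<^sub>R Im (ux z) + Im h *\<^sub>R Im (uy z))) (at z)"
      using has_derivative_Im[OF du[OF z]] by simp
    show "((\<lambda>z. Im (ux z)) has_derivative (\<lambda>h. Re h *\<^sub>R Im (uxx z) + Im h *\<^sub>R Im (uxy z))) (at z)"
      using has_derivative_Im[OF dux[OF z]] by simp
    show "((\<lambda>z. Im (uy z)) has_derivative (\<lambda>h. Re h *\<^sub>R Im (uyx z) + Im h *\<^sub>R Im (uyy z))) (at z)"
      using has_derivative_Im[OF duy[OF z]] by simp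
  qed (auto intro!: continuous_intros cont)
qed

text \<open>The Wirtinger derivative of \<open>u\<close> in z is holomorphic, since vanishing
  Laplacian and symmetric mixed derivatives are its Cauchy-Riemann equations. A primitive
  \<open>F\<close> exists on the convex disk, and \<open>u - F\<close> is then
  antiholomorphic.\<close>

lemma harmonic_on_disk_decompose:
  assumes "harmonic_on u (ball 0 1)"
  obtains F G where "F holomorphic_on ball 0 1" "G holomorphic_on ball 0 1"
    "\<And>z. z \<in> ball 0 1 \<Longrightarrow> u z = F z + cnj (G z)"
proof -
  obtain ux uy uxx uxy uyx uyy where
    du: "\<And>z. z \<in> ball 0 1 \<Longrightarrow> (u has_derivative (\<lambda>h. Re h *\<^sub>R ux z + Im h *\<^sub>R uy z)) (at z)"
    and dux: "\<And>z. z \<in> ball 0 1 \<Longrightarrow> (ux has_derivative (\<lambda>h. Re h *\<^sub>R uxx z + Im h *\<^sub>R uxy z)) (at z)"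
    and duy: "\<And>z. z \<in> ball 0 1 \<Longrightarrow> (uy has_derivative (\<lambda>h. Re h *\<^sub>R uyx z + Im h *\<^sub>R uyy z)) (at z)"
    and lap: "\<And>z. z \<in> ball 0 1 \<Longrightarrow> uxx z + uyy z = 0"
    and cont: "continuous_on (ball 0 1) uxy" "continuous_on (ball 0 1) uyx"
    using assms unfolding harmonic_on_def by blast
  define D where "D = (\<lambda>z. 1 / 2 * (ux z - \<i> * uy z))"
  have D: "(D has_field_derivative ((uxx z - \<i> * uyx z) / 2)) (at z)" if z: "z \<in> ball 0 1" for z
  proof -
    have sym: "uxy z = uyx z"
      by (rule mixed_partial_derivatives_eq[OF open_ball z du dux duy cont]) auto
    have yy: "uyy z = - uxx z" using lap[OF z] by (simp add: eq_neg_iff_add_eq_0 add.commute)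
    have "(D has_derivative (\<lambda>h. 1 / 2 * ((Re h *\<^sub>R uxx z + Im h *\<^sub>R uxy z)
        - \<i> * (Re h *\<^sub>R uyx z + Im h *\<^sub>R uyy z)))) (at z)"
      unfolding D_def by (intro has_derivative_mult_right has_derivative_diff dux[OF z] duy[OF z])
    also have "(\<lambda>h. 1 / 2 * ((Re h *\<^sub>R uxx z + Im h *\<^sub>R uxy z)
        - \<i> * (Re h *\<^sub>R uyx z + Im h *\<^sub>R uyy z))) = (*) ((uxx z - \<i> * uyx z) / 2)"
      by (rule ext) (simp add: sym yy complex_eq_iff algebra_simps add_divide_distrib diff_divide_distrib)
    finally show ?thesis unfolding has_field_derivative_def .
  qed
  have "D holomorphic_on ball 0 1"
    using D unfolding holomorphic_on_def field_differentiable_def by (blast intro: has_field_derivative_at_within)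
  then obtain F where F: "\<And>z. z \<in> ball 0 1 \<Longrightarrow> (F has_field_derivative D z) (at z within ball 0 1)"
    using holomorphic_convex_primitive'[of "ball 0 1" D] by auto
  then have F': "(F has_field_derivative D z) (at z)" if "z \<in> ball 0 1" for z
    using that at_within_open[OF that open_ball] by metis
  \<comment> \<open>\<open>D\<close> cancels the z-derivative of \<open>u - F\<close>; what remains
    is linear in \<open>cnj h\<close>, so the conjugate is complex differentiable.\<close>
  define G where "G = (\<lambda>z. cnj (u z - F z))"
  have G: "(G has_field_derivative cnj ((ux z + \<i> * uy z) / 2)) (at z)" if z: "z \<in> ball 0 1" for z
  proof -
    have "(G has_derivative (\<lambda>h. cnj ((Re h *\<^sub>R ux z + Im h *\<^sub>R uy z) - D z * h))) (at z)"
      unfolding G_def using F'[OF z]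
      by (intro has_derivative_cnj has_derivative_diff du[OF z]) (simp add: has_field_derivative_def)
    also have "(\<lambda>h. cnj ((Re h *\<^sub>R ux z + Im h *\<^sub>R uy z) - D z * h)) = (*) (cnj ((ux z + \<i> * uy z) / 2))"
      by (rule ext) (simp add: D_def complex_eq_iff algebra_simps add_divide_distrib diff_divide_distrib)
    finally show ?thesis unfolding has_field_derivative_def .
  qed
  show thesis
  proof (rule that)
    show "F holomorphic_on ball 0 1"
      using F unfolding holomorphic_on_def field_differentiable_def by blast
    show "G holomorphic_on ball 0 1"
      using G unfolding holomorphic_on_def field_differentiable_def by (blast intro: has_field_derivative_at_within)
  qed (simp add: G_def)
qed

section \<open>Closure properties of harmonicity and holomorphic examples\<close>

lemma harmonic_on_cong:
  assumes "open S" "harmonic_on u S" "\<And>z. z \<in> S \<Longrightarrow> u z = v z"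
  shows "harmonic_on v S"
proof -
  obtain ux uy uxx uxy uyx uyy where *:
    "\<forall>z\<in>S. (u has_derivative (\<lambda>h. Re h *\<^sub>R ux z + Im h *\<^sub>R uy z)) (at z) \<and>
      (ux has_derivative (\<lambda>h. Re h *\<^sub>R uxx z + Im h *\<^sub>R uxy z)) (at z) \<and>
      (uy has_derivative (\<lambda>h. Re h *\<^sub>R uyx z + Im h *\<^sub>R uyy z)) (at z) \<and> uxx z + uyy z = 0"
    "continuous_on S uxx" "continuous_on S uxy" "continuous_on S uyx" "continuous_on S uyy"
    using assms(2) unfolding harmonic_on_def by blast
  have "(v has_derivative (\<lambda>h. Re h *\<^sub>R ux z + Im h *\<^sub>R uy z)) (at z)" if "z \<in> S" for z
  proof (rule has_derivative_transform_within_open[OF _ assms(1) that])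
    show "(u has_derivative (\<lambda>h. Re h *\<^sub>R ux z + Im h *\<^sub>R uy z)) (at z)"
      using *(1) that by blast
  qed (rule assms(3))
  then show ?thesis unfolding harmonic_on_def using * by blast
qed

lemma harmonic_on_cnj:
  assumes "harmonic_on u S"
  shows "harmonic_on (\<lambda>z. cnj (u z)) S"
proof -
  obtain ux uy uxx uxy uyx uyy where u:
    "\<And>z. z \<in> S \<Longrightarrow> (u has_derivative (\<lambda>h. Re h *\<^sub>R ux z + Im h *\<^sub>R uy z)) (at z)"
    "\<And>z. z \<in> S \<Longrightarrow> (ux has_derivative (\<lambda>h. Re h *\<^sub>R uxx z + Im h *\<^sub>R uxy z)) (at z)"
    "\<And>z. z \<in> S \<Longrightarrow> (uy has_derivative (\<lambda>h. Re h *\<^sub>R uyx z + Im h *\<^sub>R uyy z)) (at z)"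
    "\<And>z. z \<in> S \<Longrightarrow> uxx z + uyy z = 0"
    "continuous_on S uxx" "continuous_on S uxy" "continuous_on S uyx" "continuous_on S uyy"
    using assms unfolding harmonic_on_def by blast
  have cnj_der: "((\<lambda>z. cnj (f z)) has_derivative (\<lambda>h. Re h *\<^sub>R cnj a + Im h *\<^sub>R cnj b)) (at z)"
    if "(f has_derivative (\<lambda>h. Re h *\<^sub>R a + Im h *\<^sub>R b)) (at z)" for f a b z
    using has_derivative_cnj[OF that] by simp
  have lap: "cnj (uxx z) + cnj (uyy z) = 0" if "z \<in> S" for z
    using u(4)[OF that] by (metis complex_cnj_add complex_cnj_zero)
  show ?thesis unfolding harmonic_on_def
    by (rule exI[of _ "\<lambda>z. cnj (ux z)"], rule exI[of _ "\<lambda>z. cnj (uy z)"],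
        rule exI[of _ "\<lambda>z. cnj (uxx z)"], rule exI[of _ "\<lambda>z. cnj (uxy z)"],
        rule exI[of _ "\<lambda>z. cnj (uyx z)"], rule exI[of _ "\<lambda>z. cnj (uyy z)"])
      (use u lap in \<open>auto intro!: cnj_der continuous_intros\<close>)
qed

lemma harmonic_on_add_scaled:
  assumes "harmonic_on u S" "harmonic_on v S"
  shows "harmonic_on (\<lambda>z. u z + c * v z) S"
proof -
  obtain ux uy uxx uxy uyx uyy where u:
    "\<And>z. z \<in> S \<Longrightarrow> (u has_derivative (\<lambda>h. Re h *\<^sub>R ux z + Im h *\<^sub>R uy z)) (at z)"
    "\<And>z. z \<in> S \<Longrightarrow> (ux has_derivative (\<lambda>h. Re h *\<^sub>R uxx z + Im h *\<^sub>R uxy z)) (at z)"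
    "\<And>z. z \<in> S \<Longrightarrow> (uy has_derivative (\<lambda>h. Re h *\<^sub>R uyx z + Im h *\<^sub>R uyy z)) (at z)"
    "\<And>z. z \<in> S \<Longrightarrow> uxx z + uyy z = 0"
    "continuous_on S uxx" "continuous_on S uxy" "continuous_on S uyx" "continuous_on S uyy"
    using assms(1) unfolding harmonic_on_def by blast
  obtain vx vy vxx vxy vyx vyy where v:
    "\<And>z. z \<in> S \<Longrightarrow> (v has_derivative (\<lambda>h. Re h *\<^sub>R vx z + Im h *\<^sub>R vy z)) (at z)"
    "\<And>z. z \<in> S \<Longrightarrow> (vx has_derivative (\<lambda>h. Re h *\<^sub>R vxx z + Im h *\<^sub>R vxy z)) (at z)"
    "\<And>z. z \<in> S \<Longrightarrow> (vy has_derivative (\<lambda>h. Re h *\<^sub>R vyx z + Im h *\<^sub>R vyy z)) (at z)"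
    "\<And>z. z \<in> S \<Longrightarrow> vxx z + vyy z = 0"
    "continuous_on S vxx" "continuous_on S vxy" "continuous_on S vyx" "continuous_on S vyy"
    using assms(2) unfolding harmonic_on_def by blast
  have comb: "((\<lambda>z. f z + c * g z) has_derivative (\<lambda>h. Re h *\<^sub>R (a + c * a') + Im h *\<^sub>R (b + c * b'))) (at z)"
    if "(f has_derivative (\<lambda>h. Re h *\<^sub>R a + Im h *\<^sub>R b)) (at z)"
      "(g has_derivative (\<lambda>h. Re h *\<^sub>R a' + Im h *\<^sub>R b')) (at z)" for f g a b a' b' z
    using has_derivative_add[OF that(1) has_derivative_mult_right[OF that(2), of c]]
    by (simp add: algebra_simps)
  have lap: "uxx z + c * vxx z + (uyy z + c * vyy z) = 0" if "z \<in> S" for z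
    using u(4)[OF that] v(4)[OF that]
    by (simp add: add_eq_0_iff2 algebra_simps flip: minus_unique)
  show ?thesis unfolding harmonic_on_def
    by (rule exI[of _ "\<lambda>z. ux z + c * vx z"], rule exI[of _ "\<lambda>z. uy z + c * vy z"],
        rule exI[of _ "\<lambda>z. uxx z + c * vxx z"], rule exI[of _ "\<lambda>z. uxy z + c * vxy z"],
        rule exI[of _ "\<lambda>z. uyx z + c * vyx z"], rule exI[of _ "\<lambda>z. uyy z + c * vyy z"])
      (use u v lap in \<open>auto intro!: comb continuous_intros\<close>)
qed

lemma holomorphic_imp_harmonic_on:
  assumes "open S" "f holomorphic_on S"
  shows "harmonic_on f S"
proof -
  have hol1: "deriv f holomorphic_on S" and hol2: "deriv (deriv f) holomorphic_on S"
    using assms by (auto intro!: holomorphic_deriv)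
  have der: "(g has_derivative (\<lambda>h. Re h *\<^sub>R deriv g z + Im h *\<^sub>R (\<i> * deriv g z))) (at z)"
    if "g holomorphic_on S" "z \<in> S" for g z
  proof -
    have "(g has_derivative (*) (deriv g z)) (at z)"
      using holomorphic_derivI[OF that(1) assms(1) that(2), of UNIV] by (simp add: has_field_derivative_def)
    also have "(*) (deriv g z) = (\<lambda>h. Re h *\<^sub>R deriv g z + Im h *\<^sub>R (\<i> * deriv g z))"
      by (rule ext) (simp add: complex_eq_iff algebra_simps)
    finally show ?thesis .
  qed
  have der': "((\<lambda>z. \<i> * deriv f z) has_derivative
      (\<lambda>h. Re h *\<^sub>R (\<i> * deriv (deriv f) z) + Im h *\<^sub>R (- deriv (deriv f) z))) (at z)"
    if "z \<in> S" for z
    using has_derivative_mult_right[OF der[OF hol1 that], of \<i>]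
    by (rule has_derivative_eq_rhs) (simp add: fun_eq_iff complex_eq_iff)
  have cont: "continuous_on S (deriv (deriv f))"
    by (rule holomorphic_on_imp_continuous_on[OF hol2])
  show ?thesis unfolding harmonic_on_def
    by (rule exI[of _ "deriv f"], rule exI[of _ "\<lambda>z. \<i> * deriv f z"],
        rule exI[of _ "deriv (deriv f)"], rule exI[of _ "\<lambda>z. \<i> * deriv (deriv f) z"],
        rule exI[of _ "\<lambda>z. \<i> * deriv (deriv f) z"], rule exI[of _ "\<lambda>z. - deriv (deriv f) z"])
      (use der[OF assms(2)] der[OF hol1] der' cont in
        \<open>auto intro!: continuous_intros\<close>)
qed

section \<open>Radial functions with vanishing moments\<close>

lemma measurable_cnj [measurable]: "cnj \<in> borel \<rightarrow>\<^sub>M borel"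
  by (intro borel_measurable_continuous_onI continuous_intros)

lemma radial_cis_mult:
  assumes "radial f" "z \<in> unit_disk"
  shows "f (cis t * z) = f z"
  using assms(1)[unfolded radial_def, rule_format, of "cis t * z" z] assms(2) by (simp add: norm_mult)

text \<open>Diagonal monomials are the powers |z|^(2k), covered by \<open>mom\<close>; the others
  have nonzero angular degree j - k and integrate to 0 by rotation.\<close>

lemma moments_eq_0:
  assumes meas: "\<rho> \<in> borel_measurable disk_measure" and "radial \<rho>"
    and mom: "\<And>n. (LINT z|disk_measure. \<rho> z * of_real (cmod z) ^ (2 * n)) = 0"
  shows "(LINT z|disk_measure. \<rho> z * (z ^ j * cnj z ^ k)) = 0"
proof (cases "j = k")
  case True
  have "z ^ k * cnj z ^ k = of_real (cmod z) ^ (2 * k)" for z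
  proof -
    have "(of_real (cmod z))\<^sup>2 = z * cnj z"
      by (simp only: complex_norm_square of_real_power[symmetric])
    then show ?thesis by (simp add: power_mult power_mult_distrib)
  qed
  then show ?thesis using mom[of k] True by simp
next
  case False
  show ?thesis
  proof (rule integral_disk_homogeneous_eq_0)
    show "(\<lambda>z. \<rho> z * (z ^ j * cnj z ^ k)) \<in> borel_measurable disk_measure"
      using meas by measurable
    show "int j - int k \<noteq> 0" using False by simp
    show "AE z in disk_measure. \<rho> (cis t * z) * ((cis t * z) ^ j * cnj (cis t * z) ^ k)
        = cis (of_int (int j - int k) * t) * (\<rho> z * (z ^ j * cnj z ^ k))" for t
    proof (rule AE_I2)
      fix z assume "z \<in> space disk_measure"
      then have *: "\<rho> (cis t * z) = \<rho> z" using radial_cis_mult[OF \<open>radial \<rho>\<close>] by simp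
      have "cis (of_int (int j - int k) * t) = cis t ^ j * cnj (cis t) ^ k"
        unfolding cis_cnj Complex.DeMoivre cis_mult by (simp add: algebra_simps)
      then show "\<rho> (cis t * z) * ((cis t * z) ^ j * cnj (cis t * z) ^ k)
        = cis (of_int (int j - int k) * t) * (\<rho> z * (z ^ j * cnj z ^ k))"
        unfolding * by (simp add: power_mult_distrib mult_ac)
    qed
  qed
qed

text \<open>Bounded measurable functions orthogonal to all z^j cnj z^k form a class closed under
  linear combinations and under multiplication by such monomials, hence by any polynomial in the two
  real coordinates. This prepares the use of Stone-Weierstrass on the disk.\<close>

lemma annihilates_real_polynomial_function:
  fixes h :: "complex \<Rightarrow> complex"
  assumes "real_polynomial_function g"
    and "h \<in> borel_measurable disk_measure" and "\<exists>B. \<forall>z\<in>unit_disk. norm (h z) \<le> B"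
    and "\<And>j k. (LINT z|disk_measure. h z * (z ^ j * cnj z ^ k)) = 0"
  shows "(\<lambda>z. h z * of_real (g z)) \<in> borel_measurable disk_measure
    \<and> (\<exists>B. \<forall>z\<in>unit_disk. norm (h z * of_real (g z)) \<le> B)
    \<and> (\<forall>j k. (LINT z|disk_measure. h z * of_real (g z) * (z ^ j * cnj z ^ k)) = 0)"
proof -
  define P :: "(complex \<Rightarrow> complex) \<Rightarrow> bool" where
    "P = (\<lambda>h. h \<in> borel_measurable disk_measure \<and> (\<exists>B. \<forall>z\<in>unit_disk. norm (h z) \<le> B)
      \<and> (\<forall>j k. (LINT z|disk_measure. h z * (z ^ j * cnj z ^ k)) = 0))"
  have int: "integrable disk_measure (\<lambda>z. h z * (z ^ j * cnj z ^ k))" if h: "P h" for h j k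
  proof -
    obtain B where B: "\<And>z. z \<in> unit_disk \<Longrightarrow> norm (h z) \<le> B" using h unfolding P_def by blast
    have [measurable]: "h \<in> borel_measurable disk_measure" using h by (simp add: P_def)
    have m: "(\<lambda>z. h z * (z ^ j * cnj z ^ k)) \<in> borel_measurable disk_measure" by measurable
    show ?thesis
    proof (rule integrable_disk_bounded[OF m, of B])
      fix z assume z: "z \<in> unit_disk"
      have "norm (z ^ j * cnj z ^ k) \<le> 1 * 1"
        unfolding norm_mult norm_power complex_mod_cnj using z by (intro mult_mono power_le_one) auto
      then have "norm (h z) * norm (z ^ j * cnj z ^ k) \<le> B * 1"
        using B[OF z] order_trans[OF norm_ge_zero B[OF z]] by (intro mult_mono) auto
      then show "norm (h z * (z ^ j * cnj z ^ k)) \<le> B" by (simp add: norm_mult)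
    qed
  qed
  have comb: "P (\<lambda>z. a * f z + b * g z)" if f: "P f" and g: "P g" for f g a b
  proof -
    have [measurable]: "f \<in> borel_measurable disk_measure" "g \<in> borel_measurable disk_measure"
      using f g by (auto simp: P_def)
    obtain A B where AB: "\<And>z. z \<in> unit_disk \<Longrightarrow> norm (f z) \<le> A" "\<And>z. z \<in> unit_disk \<Longrightarrow> norm (g z) \<le> B"
      using f g unfolding P_def by blast
    have "norm (a * f z + b * g z) \<le> norm a * A + norm b * B" if "z \<in> unit_disk" for z
      using AB[OF that] by (intro order_trans[OF norm_triangle_ineq] add_mono)
        (auto simp: norm_mult intro: mult_left_mono)
    moreover have "(LINT z|disk_measure. (a * f z + b * g z) * (z ^ j * cnj z ^ k)) = 0" for j k
    proof -
      have "(LINT z|disk_measure. (a * f z + b * g z) * (z ^ j * cnj z ^ k))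
          = (LINT z|disk_measure. a * (f z * (z ^ j * cnj z ^ k)) + b * (g z * (z ^ j * cnj z ^ k)))"
        by (simp add: algebra_simps)
      also have "\<dots> = a * (LINT z|disk_measure. f z * (z ^ j * cnj z ^ k))
          + b * (LINT z|disk_measure. g z * (z ^ j * cnj z ^ k))"
        by (subst Bochner_Integration.integral_add) (simp_all add: int[OF f] int[OF g])
      finally show ?thesis using f g by (simp add: P_def)
    qed
    moreover have "(\<lambda>z. a * f z + b * g z) \<in> borel_measurable disk_measure" by measurable
    ultimately show ?thesis unfolding P_def by blast
  qed
  have mon: "P (\<lambda>z. h z * (z ^ m * cnj z ^ n))" if h: "P h" for h m n
  proof -
    have [measurable]: "h \<in> borel_measurable disk_measure" using h by (auto simp: P_def)
    obtain B where B: "\<And>z. z \<in> unit_disk \<Longrightarrow> norm (h z) \<le> B" using h unfolding P_def by blast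
    have "norm (h z * (z ^ m * cnj z ^ n)) \<le> B" if z: "z \<in> unit_disk" for z
    proof -
      have "norm (z ^ m * cnj z ^ n) \<le> 1 * 1"
        unfolding norm_mult norm_power complex_mod_cnj using z by (intro mult_mono power_le_one) auto
      then have "norm (h z) * norm (z ^ m * cnj z ^ n) \<le> B * 1"
        using B[OF z] order_trans[OF norm_ge_zero B[OF z]] by (intro mult_mono) auto
      then show ?thesis by (simp add: norm_mult)
    qed
    moreover have "(LINT z|disk_measure. h z * (z ^ m * cnj z ^ n) * (z ^ j * cnj z ^ k)) = 0" for j k
    proof -
      have "(LINT z|disk_measure. h z * (z ^ (m + j) * cnj z ^ (n + k))) = 0"
        using h by (simp add: P_def)
      then show ?thesis by (simp add: power_add mult_ac)
    qed
    moreover have "(\<lambda>z. h z * (z ^ m * cnj z ^ n)) \<in> borel_measurable disk_measure" by measurable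
    ultimately show ?thesis unfolding P_def by blast
  qed
  \<comment> \<open>Quantifying over \<open>h\<close> makes the product case of the induction two successive multiplications.\<close>
  have "\<forall>h. P h \<longrightarrow> P (\<lambda>z. h z * of_real (g z))"
    using assms(1)
  proof (induction g rule: real_polynomial_function.induct)
    case (linear g)
    show ?case
    proof (intro allI impI)
      fix h assume h: "P h"
      \<comment> \<open>Every real-linear functional on the plane is z \<mapsto> a z + cnj a cnj z;
        this \<open>a\<close> is read off from its values at 1 and \<i>.\<close>
      define a where "a = (of_real (g 1) - \<i> * of_real (g \<i>)) / 2"
      have g: "of_real (g z) = a * z + cnj a * cnj z" for z
      proof -
        have "Re z *\<^sub>R 1 + Im z *\<^sub>R \<i> = z" by (simp add: complex_eq_iff)
        then have "g z = g (Re z *\<^sub>R 1 + Im z *\<^sub>R \<i>)" by (simp only:)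
        also have "\<dots> = Re z * g 1 + Im z * g \<i>"
          using linear by (simp only: bounded_linear.linear linear_add linear_scale real_scaleR_def)
        finally show ?thesis by (simp add: a_def complex_eq_iff field_simps)
      qed
      have "P (\<lambda>z. a * (h z * (z ^ 1 * cnj z ^ 0)) + cnj a * (h z * (z ^ 0 * cnj z ^ 1)))"
        by (intro comb mon h)
      then show "P (\<lambda>z. h z * of_real (g z))"
        by (simp add: g algebra_simps)
    qed
  next
    case (const c)
    show ?case
    proof (intro allI impI)
      fix h assume "P h"
      from comb[OF this this, of "of_real c" 0] show "P (\<lambda>z. h z * of_real c)"
        by (simp add: mult.commute)
    qed
  next
    case (add f g)
    show ?case
    proof (intro allI impI)
      fix h assume "P h"
      with add have "P (\<lambda>z. 1 * (h z * of_real (f z)) + 1 * (h z * of_real (g z)))"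
        by (intro comb) blast+
      then show "P (\<lambda>z. h z * of_real (f z + g z))"
        by (simp add: algebra_simps)
    qed
  next
    case (mult f g)
    show ?case
    proof (intro allI impI)
      fix h assume "P h"
      with mult have "P (\<lambda>z. (h z * of_real (f z)) * of_real (g z))" by blast
      then show "P (\<lambda>z. h z * of_real (f z * g z))"
        by (simp add: mult.assoc)
    qed
  qed
  then show ?thesis using assms unfolding P_def by blast
qed

text \<open>Stone-Weierstrass makes \<rho> orthogonal to continuous functions. Testing against
  bounded continuous functions that converge almost everywhere to \<open>cnj \<rho>\<close> yields
  that the integral of |\<rho>|^2 is 0.\<close>

lemma radial_moments_0_imp_AE_0:
  assumes meas: "\<rho> \<in> borel_measurable disk_measure" and "radial \<rho>"
    and bd: "\<And>z. z \<in> unit_disk \<Longrightarrow> norm (\<rho> z) \<le> B"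
    and mom: "\<And>n. (LINT z|disk_measure. \<rho> z * of_real (cmod z) ^ (2 * n)) = 0"
  shows "AE z in disk_measure. \<rho> z = 0"
proof -
  note [measurable] = meas
  have B0: "B \<ge> 0" using order_trans[OF norm_ge_zero bd[of 0]] by simp
  define D where "D = measure disk_measure unit_disk"
  have D0: "D \<ge> 0" by (simp add: D_def)
  have real_cont: "(LINT z|disk_measure. \<rho> z * of_real (g z)) = 0"
    if g: "continuous_on UNIV g" for g :: "complex \<Rightarrow> real"
  proof -
    have [measurable]: "g \<in> borel_measurable borel" using g by (rule borel_measurable_continuous_onI)
    have le: "norm (LINT z|disk_measure. \<rho> z * of_real (g z)) \<le> e * (B * D)" if e: "e > 0" for e
    proof -
      obtain p where p: "real_polynomial_function p" "\<And>z. z \<in> cball 0 1 \<Longrightarrow> \<bar>g z - p z\<bar> < e"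
        using Stone_Weierstrass_real_polynomial_function[of "cball 0 1" g e] e
          continuous_on_subset[OF g] by auto
      have "\<exists>B. \<forall>z\<in>unit_disk. norm (\<rho> z) \<le> B" using bd by blast
      note * = annihilates_real_polynomial_function[OF p(1) meas this moments_eq_0[OF meas \<open>radial \<rho>\<close> mom]]
      have P: "(\<lambda>z. \<rho> z * of_real (p z)) \<in> borel_measurable disk_measure"
        "\<exists>B. \<forall>z\<in>unit_disk. norm (\<rho> z * of_real (p z)) \<le> B"
        using * by blast+
      have "(LINT z|disk_measure. \<rho> z * of_real (p z) * (z ^ 0 * cnj z ^ 0)) = 0"
        using * by blast
      then have P3: "(LINT z|disk_measure. \<rho> z * of_real (p z)) = 0" by simp
      have ip: "integrable disk_measure (\<lambda>z. \<rho> z * of_real (p z))"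
        using P(2) integrable_disk_bounded[OF P(1)] by blast
      have dm: "(\<lambda>z. \<rho> z * of_real (g z) - \<rho> z * of_real (p z)) \<in> borel_measurable disk_measure"
        using P(1) by measurable
      have db: "norm (\<rho> z * of_real (g z) - \<rho> z * of_real (p z)) \<le> B * e" if z: "z \<in> unit_disk" for z
      proof -
        have "norm (\<rho> z * of_real (g z) - \<rho> z * of_real (p z)) = norm (\<rho> z) * \<bar>g z - p z\<bar>"
          by (simp flip: right_diff_distrib of_real_diff add: norm_mult)
        also have "\<dots> \<le> B * e" using p(2)[of z] z bd[OF z] B0 by (intro mult_mono) auto
        finally show ?thesis .
      qed
      have id: "integrable disk_measure (\<lambda>z. \<rho> z * of_real (g z) - \<rho> z * of_real (p z))"
        using integrable_disk_bounded[OF dm db] .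
      have "(LINT z|disk_measure. \<rho> z * of_real (g z))
          = (LINT z|disk_measure. (\<rho> z * of_real (g z) - \<rho> z * of_real (p z)) + \<rho> z * of_real (p z))"
        by simp
      also have "\<dots> = (LINT z|disk_measure. \<rho> z * of_real (g z) - \<rho> z * of_real (p z))"
        by (subst Bochner_Integration.integral_add[OF id ip]) (simp add: P3)
      also have "norm \<dots> \<le> (LINT z|disk_measure. norm (\<rho> z * of_real (g z) - \<rho> z * of_real (p z)))"
        by (rule integral_norm_bound)
      also have "\<dots> \<le> (LINT z|disk_measure. B * e)"
        using id db by (intro integral_mono) auto
      also have "\<dots> = e * (B * D)" by (simp add: D_def)
      finally show ?thesis .
    qed
    have "norm (LINT z|disk_measure. \<rho> z * of_real (g z)) \<le> 0"
    proof (rule field_le_epsilon)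
      fix e :: real assume e: "e > 0"
      \<comment> \<open>The added 1 keeps the denominator positive when \<open>B * D\<close> is
        0.\<close>
      define e' where "e' = e / (B * D + 1)"
      have BD: "B * D \<ge> 0" using B0 D0 by simp
      then have "e' > 0" using e by (simp add: e'_def)
      have "e' * (B * D) \<le> e' * (B * D + 1)" using \<open>e' > 0\<close> by simp
      also have "\<dots> = e" using BD by (simp add: e'_def)
      finally show "norm (LINT z|disk_measure. \<rho> z * of_real (g z)) \<le> 0 + e"
        using le[OF \<open>e' > 0\<close>] by simp
    qed
    then show ?thesis by simp
  qed
  have cont: "(LINT z|disk_measure. \<rho> z * g z) = 0"
    if g: "continuous_on UNIV g" and gb: "\<And>z. norm (g z) \<le> C" for g :: "complex \<Rightarrow> complex" and C
  proof -
    have [measurable]: "g \<in> borel_measurable borel" using g by (rule borel_measurable_continuous_onI)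
    have C0: "C \<ge> 0" using order_trans[OF norm_ge_zero gb] .
    have i: "integrable disk_measure (\<lambda>z. \<rho> z * of_real (Re (g z)))"
      "integrable disk_measure (\<lambda>z. \<rho> z * of_real (Im (g z)))"
      using bd B0 C0 order_trans[OF abs_Re_le_cmod gb] order_trans[OF abs_Im_le_cmod gb]
      by (auto intro!: integrable_disk_bounded[of _ "B * C"] mult_mono simp: norm_mult)
    have eq: "\<rho> z * g z = \<rho> z * of_real (Re (g z)) + \<i> * (\<rho> z * of_real (Im (g z)))" for z
      by (subst complex_eq[of "g z"]) (simp add: algebra_simps)
    have i2: "integrable disk_measure (\<lambda>z. \<i> * (\<rho> z * of_real (Im (g z))))"
      using i(2) by simp
    have "(LINT z|disk_measure. \<rho> z * of_real (Re (g z))) = 0"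
      "(LINT z|disk_measure. \<rho> z * of_real (Im (g z))) = 0"
      using g by (auto intro!: real_cont continuous_intros)
    then show ?thesis unfolding eq
      by (subst Bochner_Integration.integral_add[OF i(1) i2]) simp
  qed
  \<comment> \<open>This form of measurability directly provides continuous functions converging to
    \<rho> off a negligible set.\<close>
  have "\<rho> measurable_on unit_disk"
    using meas by (subst measurable_on_iff_borel_measurable) (auto simp: disk_measure_def)
  then obtain N g where N: "negligible N" and g: "\<And>n. continuous_on UNIV (g n)"
    and lim: "\<And>x. x \<notin> N \<Longrightarrow> (\<lambda>n. g n x) \<longlonglongrightarrow> (if x \<in> unit_disk then \<rho> x else 0)"
    unfolding measurable_on_def by blast
  define C where "C = B + 1"
  have C: "C > 0" "B < C" using B0 by (auto simp: C_def)
  \<comment> \<open>Conjugation after the radial retraction onto the closed disk of radius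
    \<open>C\<close>. It supplies the uniform bound that the approximants \<open>g n\<close> lack
    and equals \<open>cnj\<close> on all values of \<rho>.\<close>
  define \<tau> :: "complex \<Rightarrow> complex" where "\<tau> = (\<lambda>w. cnj (of_real (C / max C (cmod w)) * w))"
  have \<tau>_cont: "continuous_on UNIV \<tau>"
    unfolding \<tau>_def using C by (intro continuous_intros) auto
  have \<tau>_bd: "norm (\<tau> w) \<le> C" for w
  proof -
    have "norm (\<tau> w) = C / max C (cmod w) * cmod w"
      using C by (simp add: \<tau>_def norm_mult norm_divide)
    also have "\<dots> \<le> C / max C (cmod w) * max C (cmod w)"
      using C by (intro mult_left_mono) auto
    also have "\<dots> = C" using C by simp
    finally show ?thesis .
  qed
  have \<tau>_id: "\<tau> w = cnj w" if "norm w \<le> B" for w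
    using C that by (simp add: \<tau>_def max_def)
  have \<tau>g: "continuous_on UNIV (\<lambda>z. \<tau> (g n z))" for n
    using continuous_on_compose2[OF \<tau>_cont g] by simp
  have [measurable]: "(\<lambda>z. \<tau> (g n z)) \<in> borel_measurable borel" for n
    using \<tau>g by (rule borel_measurable_continuous_onI)
  have "(\<lambda>n. LINT z|disk_measure. \<rho> z * \<tau> (g n z)) \<longlonglongrightarrow> (LINT z|disk_measure. \<rho> z * cnj (\<rho> z))"
  proof (rule integral_dominated_convergence[where w = "\<lambda>_. B * C"])
    have "AE z in lebesgue. z \<notin> N"
      using N by (simp add: AE_not_in negligible_iff_null_sets)
    then have "AE z in disk_measure. z \<notin> N" by (auto simp: AE_disk_measure)
    then show "AE z in disk_measure. (\<lambda>n. \<rho> z * \<tau> (g n z)) \<longlonglongrightarrow> \<rho> z * cnj (\<rho> z)"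
      using AE_space
    proof eventually_elim
      case (elim z)
      then have "(\<lambda>n. g n z) \<longlonglongrightarrow> \<rho> z" using lim[of z] by simp
      then have "(\<lambda>n. \<tau> (g n z)) \<longlonglongrightarrow> \<tau> (\<rho> z)"
        using \<tau>_cont by (auto intro: continuous_on_tendsto_compose)
      then show ?case using \<tau>_id bd elim by (auto intro: tendsto_mult)
    qed
    show "AE z in disk_measure. norm (\<rho> z * \<tau> (g n z)) \<le> B * C" for n
      using bd \<tau>_bd B0 C by (intro AE_I2) (auto simp: norm_mult intro!: mult_mono)
  qed auto
  moreover have "(LINT z|disk_measure. \<rho> z * \<tau> (g n z)) = 0" for n
    using \<tau>g \<tau>_bd by (rule cont)
  ultimately have "(LINT z|disk_measure. \<rho> z * cnj (\<rho> z)) = 0"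
    by (simp add: LIMSEQ_const_iff)
  then have "complex_of_real (LINT z|disk_measure. (cmod (\<rho> z))\<^sup>2) = 0"
    by (simp only: complex_norm_square integral_complex_of_real[symmetric])
  then have "(LINT z|disk_measure. (cmod (\<rho> z))\<^sup>2) = 0" by simp
  moreover have "integrable disk_measure (\<lambda>z. (cmod (\<rho> z))\<^sup>2)"
    using bd by (intro integrable_disk_bounded[of _ "B\<^sup>2"]) (auto intro: power_mono)
  ultimately have "AE z in disk_measure. (cmod (\<rho> z))\<^sup>2 = 0"
    by (subst (asm) integral_nonneg_eq_0_iff_AE) auto
  then show ?thesis by simp
qed

section \<open>The harmonic Bergman projection\<close>

definition angular :: "int \<Rightarrow> complex \<Rightarrow> complex" where
  "angular m z = cis (of_int m * Arg z)"

text \<open>On the disk these are z^m for m \<ge> 0 and (cnj z)^(-m) for m < 0; they are cut off to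
  satisfy the normalisation in \<open>harmonic_bergman\<close>.\<close>

definition harmonic_monomial :: "int \<Rightarrow> complex \<Rightarrow> complex" where
  "harmonic_monomial m z =
     (if z \<in> unit_disk then angular m z * of_real (cmod z) ^ nat \<bar>m\<bar> else 0)"

lemma norm_angular [simp]: "norm (angular m z) = 1"
  by (simp add: angular_def)

lemma angular_add: "angular (m + n) z = angular m z * angular n z"
  by (simp add: angular_def cis_mult algebra_simps)

lemma cnj_angular: "cnj (angular m z) = angular (- m) z"
  by (simp add: angular_def cis_cnj)

lemma angular_of_nat: "z \<noteq> 0 \<Longrightarrow> angular (int n) z = sgn z ^ n"
  by (simp add: angular_def cis_Arg[symmetric] Complex.DeMoivre)

lemma angular_cases: "angular m z = (if m \<ge> 0 then angular (int (nat m)) z else cnj (angular (int (nat (- m))) z))"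
  by (simp add: cnj_angular)

lemma angular_of_nat_mult_power: "angular (int n) z * of_real (cmod z) ^ n = z ^ n"
proof (cases "z = 0")
  case False
  then have "sgn z * of_real (cmod z) = z" by (simp add: sgn_eq)
  with False show ?thesis by (simp add: angular_of_nat flip: power_mult_distrib)
qed (cases n; simp add: angular_def)

text \<open>\<open>Arg\<close> is not additive across its branch cut. Away from 0 the factor is a
  power of \<open>sgn z\<close>, or the conjugate of one, and \<open>sgn\<close> is
  multiplicative.\<close>

lemma angular_rotate:
  assumes "z \<noteq> 0"
  shows "angular m (cis t * z) = cis (of_int m * t) * angular m z"
proof -
  have nat: "angular (int n) (cis t * z) = cis (real n * t) * angular (int n) z" for n
    using assms by (simp add: angular_of_nat sgn_mult power_mult_distrib flip: Complex.DeMoivre)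
  show ?thesis
  proof (cases "m \<ge> 0")
    case True
    then show ?thesis using nat[of "nat m"] by simp
  next
    case False
    then show ?thesis using arg_cong[OF nat[of "nat (- m)"], of cnj]
      by (simp add: cnj_angular cis_cnj)
  qed
qed

lemma measurable_angular [measurable]: "angular m \<in> borel_measurable borel"
proof -
  have *: "angular (int n) = (\<lambda>z. if z = 0 then 1 else (z / of_real (cmod z)) ^ n)" for n
    by (auto simp: fun_eq_iff angular_of_nat sgn_eq) (simp add: angular_def Arg_zero)
  have nat: "angular (int n) \<in> borel_measurable borel" for n
    unfolding * by measurable
  have "angular m = (\<lambda>z. if m \<ge> 0 then angular (int (nat m)) z else cnj (angular (int (nat (- m))) z))"
    using angular_cases by blast
  moreover have "\<dots> \<in> borel_measurable borel"
    using nat by measurable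
  ultimately show ?thesis by (simp only:)
qed

lemma harmonic_monomial_in_disk:
  "z \<in> unit_disk \<Longrightarrow> harmonic_monomial m z = angular m z * of_real (cmod z) ^ nat \<bar>m\<bar>"
  by (simp add: harmonic_monomial_def)

lemma L2_disk_bounded:
  assumes "f \<in> borel_measurable disk_measure" "\<And>z. z \<in> unit_disk \<Longrightarrow> norm (f z) \<le> B"
  shows "f \<in> L2_disk"
  unfolding L2_disk_def using assms
  by (auto intro!: integrable_disk_bounded[of _ "B\<^sup>2"] power_mono)

lemma harmonic_bergman_scaled_monomial: "(\<lambda>z. c * harmonic_monomial m z) \<in> harmonic_bergman"
proof -
  have "harmonic_on (\<lambda>z. angular m z * of_real (cmod z) ^ nat \<bar>m\<bar>) unit_disk"
  proof (cases "m \<ge> 0")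
    case True
    have "harmonic_on (\<lambda>z. z ^ nat m) unit_disk"
      by (intro holomorphic_imp_harmonic_on holomorphic_intros) auto
    then show ?thesis using True angular_of_nat_mult_power[of "nat m"] by simp
  next
    case False
    have "harmonic_on (\<lambda>z. z ^ nat (- m)) unit_disk"
      by (intro holomorphic_imp_harmonic_on holomorphic_intros) auto
    then have "harmonic_on (\<lambda>z. cnj (z ^ nat (- m))) unit_disk" by (rule harmonic_on_cnj)
    moreover have "cnj (z ^ nat (- m)) = angular m z * of_real (cmod z) ^ nat \<bar>m\<bar>" for z
      using False angular_of_nat_mult_power[of "nat (- m)" z, symmetric]
      by (simp add: cnj_angular)
    ultimately show ?thesis by simp
  qed
  then have "harmonic_on (\<lambda>z. 0 + c * (angular m z * of_real (cmod z) ^ nat \<bar>m\<bar>)) unit_disk"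
    by (rule harmonic_on_add_scaled[OF holomorphic_imp_harmonic_on[OF open_ball holomorphic_on_const]])
  then have "harmonic_on (\<lambda>z. c * harmonic_monomial m z) unit_disk"
    by (rule harmonic_on_cong[rotated]) (auto simp: harmonic_monomial_in_disk)
  moreover have "(\<lambda>z. c * harmonic_monomial m z) \<in> L2_disk"
  proof (rule L2_disk_bounded[of _ "norm c"])
    have "(\<lambda>z. c * (angular m z * of_real (cmod z) ^ nat \<bar>m\<bar>)) \<in> borel_measurable disk_measure"
      by measurable
    then show "(\<lambda>z. c * harmonic_monomial m z) \<in> borel_measurable disk_measure"
      by (subst measurable_cong[where g = "\<lambda>z. c * (angular m z * of_real (cmod z) ^ nat \<bar>m\<bar>)"])
        (simp_all add: harmonic_monomial_in_disk)
    show "norm (c * harmonic_monomial m z) \<le> norm c" if "z \<in> unit_disk" for z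
      using that by (simp add: harmonic_monomial_in_disk norm_mult norm_power mult_left_le power_le_one)
  qed
  ultimately show ?thesis
    by (simp add: harmonic_bergman_def harmonic_monomial_def)
qed

section \<open>Square integrability and uniqueness of the projection\<close>

lemma integrable_L2_product:
  assumes f: "f \<in> L2_disk" and g: "g \<in> L2_disk"
  shows "integrable disk_measure (\<lambda>z. f z * cnj (g z))"
proof (rule Bochner_Integration.integrable_bound)
  have [measurable]: "f \<in> borel_measurable disk_measure" "g \<in> borel_measurable disk_measure"
    using f g by (auto simp: L2_disk_def)
  show "integrable disk_measure (\<lambda>z. (cmod (f z))\<^sup>2 + (cmod (g z))\<^sup>2)"
    using f g by (auto simp: L2_disk_def)
  show "(\<lambda>z. f z * cnj (g z)) \<in> borel_measurable disk_measure" by measurable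
  have "norm (f z * cnj (g z)) \<le> (cmod (f z))\<^sup>2 + (cmod (g z))\<^sup>2" for z
  proof -
    have "2 * (cmod (f z) * cmod (g z)) \<le> (cmod (f z))\<^sup>2 + (cmod (g z))\<^sup>2"
      using sum_squares_bound[of "cmod (f z)" "cmod (g z)"] by simp
    moreover have "0 \<le> cmod (f z) * cmod (g z)" by simp
    ultimately show ?thesis unfolding norm_mult complex_mod_cnj by linarith
  qed
  then show "AE z in disk_measure. norm (f z * cnj (g z)) \<le> norm ((cmod (f z))\<^sup>2 + (cmod (g z))\<^sup>2)"
    by (intro AE_I2) (simp add: order_trans[OF _ abs_ge_self])
qed

lemma L2_disk_diff:
  assumes f: "f \<in> L2_disk" and g: "g \<in> L2_disk"
  shows "(\<lambda>z. f z - g z) \<in> L2_disk"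
proof -
  have [measurable]: "f \<in> borel_measurable disk_measure" "g \<in> borel_measurable disk_measure"
    using f g by (auto simp: L2_disk_def)
  have "integrable disk_measure (\<lambda>z. (cmod (f z - g z))\<^sup>2)"
  proof (rule Bochner_Integration.integrable_bound)
    show "integrable disk_measure (\<lambda>z. 2 * (cmod (f z))\<^sup>2 + 2 * (cmod (g z))\<^sup>2)"
      using f g by (auto simp: L2_disk_def)
    have "(cmod (f z - g z))\<^sup>2 \<le> 2 * (cmod (f z))\<^sup>2 + 2 * (cmod (g z))\<^sup>2" for z
    proof -
      have "(cmod (f z - g z))\<^sup>2 \<le> (cmod (f z) + cmod (g z))\<^sup>2"
        by (intro power_mono norm_triangle_ineq4) auto
      also have "\<dots> \<le> 2 * (cmod (f z))\<^sup>2 + 2 * (cmod (g z))\<^sup>2"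
        using sum_squares_bound[of "cmod (f z)" "cmod (g z)"] by (simp add: power2_sum)
      finally show ?thesis .
    qed
    then show "AE z in disk_measure. norm ((cmod (f z - g z))\<^sup>2)
        \<le> norm (2 * (cmod (f z))\<^sup>2 + 2 * (cmod (g z))\<^sup>2)"
      by (intro AE_I2) (simp add: order_trans[OF _ abs_ge_self])
  qed measurable
  then show ?thesis by (simp add: L2_disk_def)
qed

lemma harmonic_bergman_diff:
  assumes "u \<in> harmonic_bergman" "v \<in> harmonic_bergman"
  shows "(\<lambda>z. u z - v z) \<in> harmonic_bergman"
  using assms harmonic_on_add_scaled[of u unit_disk v "-1"] L2_disk_diff[of u v]
  by (simp add: harmonic_bergman_def)

lemma continuous_on_harmonic:
  assumes "harmonic_on u S"
  shows "continuous_on S u"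
  using assms unfolding harmonic_on_def
  by (meson has_derivative_continuous continuous_at_imp_continuous_on)

text \<open>Harmonic functions are continuous, so the set where \<open>w\<close> is nonzero in the
  disk is open; being negligible it is empty. This upgrades uniqueness in L2 to the pointwise
  uniqueness that the description operator needs.\<close>

lemma harmonic_bergman_norm_0_imp_0:
  assumes w: "w \<in> harmonic_bergman" and 0: "L2_inner w w = 0"
  shows "w z = 0"
proof (cases "z \<in> unit_disk")
  case True
  have "complex_of_real (LINT z|disk_measure. (cmod (w z))\<^sup>2) = 0"
    using 0 unfolding L2_inner_def
    by (simp only: complex_norm_square integral_complex_of_real[symmetric])
  then have "(LINT z|disk_measure. (cmod (w z))\<^sup>2) = 0" by simp
  moreover have "integrable disk_measure (\<lambda>z. (cmod (w z))\<^sup>2)"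
    using w by (simp add: harmonic_bergman_def L2_disk_def)
  ultimately have "AE z in disk_measure. (cmod (w z))\<^sup>2 = 0"
    by (subst (asm) integral_nonneg_eq_0_iff_AE) auto
  then have "AE z in lebesgue. z \<notin> {z\<in>unit_disk. w z \<noteq> 0}"
    by (auto simp: AE_disk_measure)
  moreover have op: "open {z\<in>unit_disk. w z \<noteq> 0}"
  proof -
    have "continuous_on unit_disk w"
      using w by (auto simp: harmonic_bergman_def intro: continuous_on_harmonic)
    then have "open (unit_disk \<inter> w -` (- {0}))"
      by (rule continuous_open_preimage) auto
    also have "unit_disk \<inter> w -` (- {0}) = {z\<in>unit_disk. w z \<noteq> 0}" by auto
    finally show ?thesis .
  qed
  moreover have "{z\<in>unit_disk. w z \<noteq> 0} \<in> sets lebesgue" using op by auto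
  ultimately have "negligible {z\<in>unit_disk. w z \<noteq> 0}"
    unfolding negligible_iff_null_sets by (subst AE_iff_null_sets) auto
  then have "{z\<in>unit_disk. w z \<noteq> 0} = {}"
    using op open_not_negligible by blast
  then show ?thesis using True by blast
qed (use w in \<open>auto simp: harmonic_bergman_def\<close>)

text \<open>The difference of two candidates lies in the space and is orthogonal to it, hence to
  itself.\<close>

lemma bergman_proj_eqI:
  assumes f: "f \<in> L2_disk" and u: "u \<in> harmonic_bergman"
    and orth: "\<And>v. v \<in> harmonic_bergman \<Longrightarrow> L2_inner (\<lambda>z. f z - u z) v = 0"
  shows "bergman_proj f = u"
  unfolding bergman_proj_def
proof (rule the_equality)
  show "u \<in> harmonic_bergman \<and> (\<forall>v\<in>harmonic_bergman. L2_inner (\<lambda>z. f z - u z) v = 0)"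
    using u orth by blast
  fix v assume v: "v \<in> harmonic_bergman \<and> (\<forall>w\<in>harmonic_bergman. L2_inner (\<lambda>z. f z - v z) w = 0)"
  define w where "w = (\<lambda>z. v z - u z)"
  have w: "w \<in> harmonic_bergman" unfolding w_def using u v by (blast intro: harmonic_bergman_diff)
  have L2: "u \<in> L2_disk" "v \<in> L2_disk" "w \<in> L2_disk"
    using u v w by (auto simp: harmonic_bergman_def)
  have "L2_inner w w = L2_inner (\<lambda>z. f z - u z) w - L2_inner (\<lambda>z. f z - v z) w"
    unfolding L2_inner_def
    by (subst Bochner_Integration.integral_diff[symmetric])
      (auto intro!: integrable_L2_product L2_disk_diff f L2 Bochner_Integration.integral_cong
        simp: w_def algebra_simps)
  also have "\<dots> = 0" using v w orth[OF w] by simp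
  finally have "w z = 0" for z by (rule harmonic_bergman_norm_0_imp_0[OF w])
  then show "v = u" by (auto simp: w_def fun_eq_iff)
qed

text \<open>In the Taylor expansion of \<open>F\<close> only the term whose degree cancels
  \<open>d\<close> survives rotation. Support in |z| < R bounds all partial sums there, so termwise
  integration needs no control of \<open>F\<close> near the circle.\<close>

lemma integral_homogeneous_mult_holomorphic:
  fixes \<kappa> F :: "complex \<Rightarrow> complex" and d :: int
  assumes meas [measurable]: "\<kappa> \<in> borel_measurable disk_measure"
    and bd: "\<And>z. z \<in> unit_disk \<Longrightarrow> norm (\<kappa> z) \<le> K"
    and R: "0 < R" "R < 1" and supp: "\<And>z. R \<le> cmod z \<Longrightarrow> \<kappa> z = 0"
    and hom: "\<And>t z. z \<in> unit_disk \<Longrightarrow> z \<noteq> 0 \<Longrightarrow> \<kappa> (cis t * z) = cis (of_int d * t) * \<kappa> z"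
    and F: "F holomorphic_on unit_disk"
  shows "(LINT z|disk_measure. \<kappa> z * F z)
    = (if d \<le> 0 then (deriv ^^ nat (- d)) F 0 / fact (nat (- d)) else 0)
      * (LINT z|disk_measure. \<kappa> z * z ^ nat (- d))"
proof -
  define a where "a = (\<lambda>n. (deriv ^^ n) F 0 / fact n)"
  define I where "I = (\<lambda>n. LINT z|disk_measure. \<kappa> z * z ^ n)"
  define A where "A = (if d \<le> 0 then a (nat (- d)) else 0)"
  have K0: "K \<ge> 0" using order_trans[OF norm_ge_zero bd[of 0]] by simp
  have ser: "(\<lambda>n. a n * z ^ n) sums F z" if "z \<in> unit_disk" for z
    using holomorphic_power_series[OF F that] by (simp add: a_def)
  have int: "integrable disk_measure (\<lambda>z. \<kappa> z * z ^ n)" for n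
  proof (rule integrable_disk_bounded[of _ K])
    show "norm (\<kappa> z * z ^ n) \<le> K" if z: "z \<in> unit_disk" for z
    proof -
      have "norm (\<kappa> z) * norm (z ^ n) \<le> K * 1"
        using bd[OF z] z K0 by (intro mult_mono) (auto simp: norm_power power_le_one)
      then show ?thesis by (simp add: norm_mult)
    qed
  qed measurable
  have I0: "I n = 0" if "d + int n \<noteq> 0" for n
    unfolding I_def
  proof (rule integral_disk_homogeneous_eq_0[OF _ that])
    show "(\<lambda>z. \<kappa> z * z ^ n) \<in> borel_measurable disk_measure" by measurable
    show "AE z in disk_measure. \<kappa> (cis t * z) * (cis t * z) ^ n
        = cis (of_int (d + int n) * t) * (\<kappa> z * z ^ n)" for t
      using AE_disk_measure_ne_0 AE_space
    proof eventually_elim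
      case (elim z)
      have "cis (of_int (d + int n) * t) = cis (of_int d * t) * cis t ^ n"
        unfolding Complex.DeMoivre cis_mult by (simp add: algebra_simps)
      then show ?case using hom[of z t] elim by (simp add: power_mult_distrib)
    qed
  qed
  \<comment> \<open>For \<open>d > 0\<close> the index \<open>nat (- d)\<close> collapses to 0;
    there \<open>I 0 = 0\<close>, in agreement with \<open>A = 0\<close>.\<close>
  have aI: "a n * I n = (if n = nat (- d) then A * I n else 0)" for n
    using I0[of n] by (auto simp: A_def)
  define M where "M = (\<Sum>n. norm (a n * of_real R ^ n))"
  \<comment> \<open>Convergence at a slightly larger radius gives absolute convergence at
    \<open>R\<close>.\<close>
  obtain R' where R': "R < R'" "R' < 1" using dense[OF R(2)] by blast
  have sumR: "summable (\<lambda>n. norm (a n * of_real R ^ n))"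
  proof (rule powser_insidea)
    show "summable (\<lambda>n. a n * of_real R' ^ n)"
      by (rule sums_summable[OF ser]) (use R R' in auto)
    show "norm (complex_of_real R) < norm (complex_of_real R')"
      using R R' by simp
  qed
  have M: "norm (\<Sum>n<N. a n * z ^ n) \<le> M" if "cmod z < R" for z N
  proof -
    have "norm (\<Sum>n<N. a n * z ^ n) \<le> (\<Sum>n<N. norm (a n * z ^ n))" by (rule norm_sum)
    also have "\<dots> \<le> (\<Sum>n<N. norm (a n * of_real R ^ n))"
      using that R by (intro sum_mono) (auto simp: norm_mult norm_power intro!: mult_left_mono power_mono)
    also have "\<dots> \<le> M" unfolding M_def by (intro sum_le_suminf sumR) auto
    finally show ?thesis .
  qed
  have M0: "M \<ge> 0" using order_trans[OF norm_ge_zero M[of 0]] R by simp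
  have F_meas: "(\<lambda>z. \<kappa> z * F z) \<in> borel_measurable disk_measure"
  proof -
    have "continuous_on unit_disk F" by (rule holomorphic_on_imp_continuous_on[OF F])
    then have "F \<in> borel_measurable (lebesgue_on unit_disk)"
      by (rule continuous_imp_measurable_on_sets_lebesgue) auto
    then have [measurable]: "F \<in> borel_measurable disk_measure" by (simp add: disk_measure_def)
    show ?thesis by measurable
  qed
  have "(\<lambda>N. LINT z|disk_measure. \<kappa> z * (\<Sum>n<N. a n * z ^ n)) \<longlonglongrightarrow> (LINT z|disk_measure. \<kappa> z * F z)"
  proof (rule integral_dominated_convergence[where w = "\<lambda>_. K * M"])
    show "AE z in disk_measure. (\<lambda>N. \<kappa> z * (\<Sum>n<N. a n * z ^ n)) \<longlonglongrightarrow> \<kappa> z * F z"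
    proof (rule AE_I2)
      fix z assume "z \<in> space disk_measure"
      then show "(\<lambda>N. \<kappa> z * (\<Sum>n<N. a n * z ^ n)) \<longlonglongrightarrow> \<kappa> z * F z"
        using ser[of z] by (intro tendsto_mult tendsto_const) (simp add: sums_def)
    qed
    show "AE z in disk_measure. norm (\<kappa> z * (\<Sum>n<N. a n * z ^ n)) \<le> K * M" for N
    proof (rule AE_I2)
      fix z assume "z \<in> space disk_measure"
      then have z: "z \<in> unit_disk" by simp
      show "norm (\<kappa> z * (\<Sum>n<N. a n * z ^ n)) \<le> K * M"
      proof (cases "cmod z < R")
        case True
        then show ?thesis unfolding norm_mult using bd[OF z] M[OF True] K0
          by (intro mult_mono) auto
      qed (use supp K0 M0 in auto)
    qed
    show "(\<lambda>z. \<kappa> z * F z) \<in> borel_measurable disk_measure" by (rule F_meas)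
    show "(\<lambda>z. \<kappa> z * (\<Sum>n<N. a n * z ^ n)) \<in> borel_measurable disk_measure" for N
      by (intro borel_measurable_times borel_measurable_sum borel_measurable_power meas) auto
  qed simp
  moreover have "eventually (\<lambda>N. (LINT z|disk_measure. \<kappa> z * (\<Sum>n<N. a n * z ^ n)) = A * I (nat (- d))) sequentially"
    using eventually_gt_at_top[of "nat (- d)"]
  proof eventually_elim
    case (elim N)
    have "(LINT z|disk_measure. \<kappa> z * (\<Sum>n<N. a n * z ^ n))
        = (LINT z|disk_measure. (\<Sum>n<N. a n * (\<kappa> z * z ^ n)))"
      by (simp add: sum_distrib_left mult_ac)
    also have "\<dots> = (\<Sum>n<N. a n * I n)"
      by (subst Bochner_Integration.integral_sum) (simp_all add: int I_def)
    also have "\<dots> = A * I (nat (- d))"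
      unfolding aI using elim by (simp add: sum.delta')
    finally show ?case .
  qed
  then have "(\<lambda>N. LINT z|disk_measure. \<kappa> z * (\<Sum>n<N. a n * z ^ n)) \<longlonglongrightarrow> A * I (nat (- d))"
    by (rule tendsto_eventually)
  ultimately have "(LINT z|disk_measure. \<kappa> z * F z) = A * I (nat (- d))"
    by (rule LIMSEQ_unique)
  then show ?thesis by (simp only: A_def a_def I_def)
qed

lemma integrable_L2_disk:
  assumes "f \<in> L2_disk"
  shows "integrable disk_measure f"
  using integrable_L2_product[OF assms, of "\<lambda>_. 1"] by (simp add: L2_disk_def)

text \<open>On |z| < R both parts of \<open>v\<close> are bounded, and rotation leaves at most one
  Taylor coefficient of each, multiplied by the same truncated moment \<open>J R\<close>. As R tends
  to 1 this moment tends to the one assumed to vanish, while the left side converges because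
  \<open>v\<close> itself is integrable.\<close>

lemma angular_orthogonal_harmonic:
  assumes meas [measurable]: "g \<in> borel_measurable disk_measure" and "radial g"
    and bd: "\<And>z. z \<in> unit_disk \<Longrightarrow> norm (g z) \<le> B"
    and mom: "(LINT z|disk_measure. g z * of_real (cmod z) ^ nat \<bar>m\<bar>) = 0"
    and v: "v \<in> harmonic_bergman"
  shows "(LINT z|disk_measure. angular m z * g z * cnj (v z)) = 0"
proof -
  have B0: "B \<ge> 0" using order_trans[OF norm_ge_zero bd[of 0]] by simp
  obtain F G where F: "F holomorphic_on unit_disk" and G: "G holomorphic_on unit_disk"
    and vFG: "\<And>z. z \<in> unit_disk \<Longrightarrow> v z = F z + cnj (G z)"
    using v harmonic_on_disk_decompose[of v] unfolding harmonic_bergman_def by blast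
  have vL2: "v \<in> L2_disk" using v by (simp add: harmonic_bergman_def)
  then have [measurable]: "v \<in> borel_measurable disk_measure" by (simp add: L2_disk_def)
  have vint: "integrable disk_measure v" by (rule integrable_L2_disk[OF vL2])
  have hol_meas: "H \<in> borel_measurable disk_measure" if "H holomorphic_on unit_disk" for H
    using continuous_imp_measurable_on_sets_lebesgue[OF holomorphic_on_imp_continuous_on[OF that]]
    by (simp add: disk_measure_def)
  note [measurable] = hol_meas[OF F] hol_meas[OF G]
  define c1 where "c1 = (\<lambda>n. (deriv ^^ n) G 0 / fact n)"
  define c2 where "c2 = (\<lambda>n. (deriv ^^ n) F 0 / fact n)"
  \<comment> \<open>As cnj v = G + cnj F, degree \<open>m\<close> meets a coefficient of
    \<open>G\<close> when m \<le> 0 and one of \<open>F\<close> when m \<ge> 0; both contribute when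
    m = 0.\<close>
  define A where "A = (if m \<le> 0 then c1 (nat (- m)) else 0) + cnj (if - m \<le> 0 then c2 (nat m) else 0)"
  define J where "J = (\<lambda>R. LINT z|disk_measure. (if cmod z < R then g z * of_real (cmod z) ^ nat \<bar>m\<bar> else 0))"
  have main: "(LINT z|disk_measure. (if cmod z < R then angular m z * g z * cnj (v z) else 0)) = A * J R"
    if R: "0 < R" "R < 1" for R
  proof -
    define \<kappa> where "\<kappa> = (\<lambda>z. if cmod z < R then angular m z * g z else 0)"
    have \<kappa>m [measurable]: "\<kappa> \<in> borel_measurable disk_measure" unfolding \<kappa>_def by measurable
    have \<kappa>b: "norm (\<kappa> z) \<le> B" if "z \<in> unit_disk" for z
      using bd[OF that] B0 by (simp add: \<kappa>_def norm_mult)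
    have \<kappa>h: "\<kappa> (cis t * z) = cis (of_int m * t) * \<kappa> z" if "z \<in> unit_disk" "z \<noteq> 0" for t z
      using radial_cis_mult[OF \<open>radial g\<close> that(1)] angular_rotate[OF that(2)]
      by (simp add: \<kappa>_def norm_mult)
    have hol_int: "integrable disk_measure (\<lambda>z. k z * H z)"
      if k: "k \<in> borel_measurable disk_measure" "\<And>z. z \<in> unit_disk \<Longrightarrow> norm (k z) \<le> B"
        "\<And>z. R \<le> cmod z \<Longrightarrow> k z = 0" and H: "H holomorphic_on unit_disk" for k H
    proof -
      note [measurable] = k(1) hol_meas[OF H]
      have "continuous_on (cball 0 R) H"
        by (rule continuous_on_subset[OF holomorphic_on_imp_continuous_on[OF H]]) (use R in auto)
      then have "bounded (H ` cball 0 R)"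
        by (intro compact_imp_bounded compact_continuous_image) auto
      then obtain C where C: "\<And>z. cmod z \<le> R \<Longrightarrow> norm (H z) \<le> C"
        unfolding bounded_iff by (metis imageI mem_cball_0)
      have C0: "C \<ge> 0" using order_trans[OF norm_ge_zero C[of 0]] R by simp
      show ?thesis
      proof (rule integrable_disk_bounded[of _ "B * C"])
        fix z assume z: "z \<in> unit_disk"
        show "norm (k z * H z) \<le> B * C"
        proof (cases "cmod z < R")
          case True
          then show ?thesis unfolding norm_mult using k(2)[OF z] C[of z] B0 by (intro mult_mono) auto
        qed (use k(3) B0 C0 in auto)
      qed measurable
    qed
    have \<kappa>c: "(\<lambda>z. cnj (\<kappa> z)) \<in> borel_measurable disk_measure" by measurable
    have 1: "(LINT z|disk_measure. \<kappa> z * G z)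
        = (if m \<le> 0 then c1 (nat (- m)) else 0) * (LINT z|disk_measure. \<kappa> z * z ^ nat (- m))"
      unfolding c1_def
      by (rule integral_homogeneous_mult_holomorphic[OF \<kappa>m \<kappa>b R _ \<kappa>h G]) (auto simp: \<kappa>_def)
    have 2: "(LINT z|disk_measure. cnj (\<kappa> z) * F z)
        = (if - m \<le> 0 then c2 (nat (- (- m))) else 0) * (LINT z|disk_measure. cnj (\<kappa> z) * z ^ nat (- (- m)))"
      unfolding c2_def
    proof (rule integral_homogeneous_mult_holomorphic[OF \<kappa>c _ R _ _ F, where K = B])
      show "norm (cnj (\<kappa> z)) \<le> B" if "z \<in> unit_disk" for z using \<kappa>b[OF that] by simp
    next
      fix t z assume "z \<in> unit_disk" "z \<noteq> 0"
      then show "cnj (\<kappa> (cis t * z)) = cis (of_int (- m) * t) * cnj (\<kappa> z)"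
        by (simp add: \<kappa>h cis_cnj)
    qed (auto simp: \<kappa>_def)
    have J1: "(LINT z|disk_measure. \<kappa> z * z ^ nat (- m)) = J R" if "m \<le> 0"
      unfolding J_def
    proof (rule Bochner_Integration.integral_cong[OF refl])
      fix z
      have "angular m z * z ^ nat (- m) = angular m z * angular (- m) z * of_real (cmod z) ^ nat \<bar>m\<bar>"
        using that angular_of_nat_mult_power[of "nat (- m)" z, symmetric] by simp
      also have "angular m z * angular (- m) z = 1"
        using angular_add[of m "- m" z] by (simp add: angular_def)
      finally show "\<kappa> z * z ^ nat (- m) = (if cmod z < R then g z * of_real (cmod z) ^ nat \<bar>m\<bar> else 0)"
        by (simp add: \<kappa>_def mult_ac)
    qed
    have J2: "cnj (LINT z|disk_measure. cnj (\<kappa> z) * z ^ nat m) = J R" if "m \<ge> 0"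
      unfolding J_def Bochner_Integration.integral_cnj[symmetric]
    proof (rule Bochner_Integration.integral_cong[OF refl])
      fix z
      have "angular m z * cnj (z ^ nat m) = angular m z * angular (- m) z * of_real (cmod z) ^ nat \<bar>m\<bar>"
        using that angular_of_nat_mult_power[of "nat m" z, symmetric] by (simp add: cnj_angular)
      also have "angular m z * angular (- m) z = 1"
        using angular_add[of m "- m" z] by (simp add: angular_def)
      finally show "cnj (cnj (\<kappa> z) * z ^ nat m)
          = (if cmod z < R then g z * of_real (cmod z) ^ nat \<bar>m\<bar> else 0)"
        by (simp add: \<kappa>_def mult_ac)
    qed
    have "(LINT z|disk_measure. (if cmod z < R then angular m z * g z * cnj (v z) else 0))
        = (LINT z|disk_measure. \<kappa> z * G z + cnj (cnj (\<kappa> z) * F z))"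
      by (rule Bochner_Integration.integral_cong[OF refl])
        (auto simp: \<kappa>_def vFG algebra_simps)
    also have "\<dots> = (LINT z|disk_measure. \<kappa> z * G z) + cnj (LINT z|disk_measure. cnj (\<kappa> z) * F z)"
    proof -
      have "integrable disk_measure (\<lambda>z. \<kappa> z * G z)"
        by (rule hol_int[OF \<kappa>m \<kappa>b _ G]) (auto simp: \<kappa>_def)
      moreover have "integrable disk_measure (\<lambda>z. cnj (\<kappa> z) * F z)"
        by (rule hol_int[OF \<kappa>c _ _ F]) (use \<kappa>b in \<open>auto simp: \<kappa>_def\<close>)
      then have "integrable disk_measure (\<lambda>z. cnj (cnj (\<kappa> z) * F z))"
        by (rule Bochner_Integration.integrable_cnj)
      ultimately show ?thesis
        by (simp only: Bochner_Integration.integral_add Bochner_Integration.integral_cnj)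
    qed
    also have "\<dots> = A * J R"
      unfolding 1 2 A_def using J1 J2 by (auto simp: algebra_simps)
    finally show ?thesis .
  qed
  \<comment> \<open>The shift by 2 keeps every radius strictly between 0 and 1, starting at
    1/2.\<close>
  define r where "r = (\<lambda>n. 1 - 1 / (real n + 2))"
  have r: "0 < r n" "r n < 1" for n by (auto simp: r_def field_simps)
  have rlim: "r \<longlonglongrightarrow> 1"
    unfolding r_def by real_asymp
  have cut: "(\<lambda>n. if cmod z < r n then x else 0) \<longlonglongrightarrow> x" if "z \<in> unit_disk" for z and x :: complex
  proof -
    have "eventually (\<lambda>n. cmod z < r n) sequentially"
      using order_tendstoD(1)[OF rlim, of "cmod z"] that by simp
    then have "eventually (\<lambda>n. (if cmod z < r n then x else 0) = x) sequentially"
      by eventually_elim simp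
    then show ?thesis by (rule tendsto_eventually)
  qed
  have "(\<lambda>n. LINT z|disk_measure. (if cmod z < r n then angular m z * g z * cnj (v z) else 0))
      \<longlonglongrightarrow> (LINT z|disk_measure. angular m z * g z * cnj (v z))"
  proof (rule integral_dominated_convergence[where w = "\<lambda>z. B * norm (v z)"])
    show "integrable disk_measure (\<lambda>z. B * norm (v z))" using vint by simp
    show "AE z in disk_measure. (\<lambda>n. if cmod z < r n then angular m z * g z * cnj (v z) else 0)
        \<longlonglongrightarrow> angular m z * g z * cnj (v z)"
      by (intro AE_I2 cut) simp
    show "AE z in disk_measure. norm (if cmod z < r n then angular m z * g z * cnj (v z) else 0)
        \<le> B * norm (v z)" for n
      using bd B0 by (intro AE_I2) (auto simp: norm_mult intro: mult_right_mono)
  qed measurable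
  moreover have "(\<lambda>n. A * J (r n)) \<longlonglongrightarrow> A * (LINT z|disk_measure. g z * of_real (cmod z) ^ nat \<bar>m\<bar>)"
    unfolding J_def
  proof (intro tendsto_mult tendsto_const integral_dominated_convergence[where w = "\<lambda>_. B"])
    show "AE z in disk_measure. (\<lambda>n. if cmod z < r n then g z * of_real (cmod z) ^ nat \<bar>m\<bar> else 0)
        \<longlonglongrightarrow> g z * of_real (cmod z) ^ nat \<bar>m\<bar>"
      by (intro AE_I2 cut) simp
    show "AE z in disk_measure. norm (if cmod z < r n then g z * of_real (cmod z) ^ nat \<bar>m\<bar> else 0) \<le> B" for n
    proof (rule AE_I2)
      fix z assume "z \<in> space disk_measure"
      then have z: "z \<in> unit_disk" by simp
      have "norm (g z) * cmod z ^ nat \<bar>m\<bar> \<le> B * 1"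
        using bd[OF z] z B0 by (intro mult_mono) (auto intro: power_le_one)
      then show "norm (if cmod z < r n then g z * of_real (cmod z) ^ nat \<bar>m\<bar> else 0) \<le> B"
        using B0 by (simp add: norm_mult norm_power)
    qed
    show "(\<lambda>z. g z * of_real (cmod z) ^ nat \<bar>m\<bar>) \<in> borel_measurable disk_measure"
      by measurable
    show "(\<lambda>z. if cmod z < r n then g z * of_real (cmod z) ^ nat \<bar>m\<bar> else 0)
        \<in> borel_measurable disk_measure" for n
      by measurable
  qed simp
  ultimately show ?thesis
    unfolding main[OF r] mom by (simp add: LIMSEQ_unique)
qed

definition disk_moment :: "(complex \<Rightarrow> complex) \<Rightarrow> nat \<Rightarrow> complex" where
  "disk_moment f n = (LINT z|disk_measure. f z * of_real (cmod z) ^ n)"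

text \<open>At even order \<open>2 n\<close> this is the squared norm of a monomial of degree n or
  -n, the divisor in the projection formula below.\<close>

lemma disk_moment_1_ne_0: "disk_moment (\<lambda>_. 1) n \<noteq> 0"
proof
  assume "disk_moment (\<lambda>_. 1) n = 0"
  then have "complex_of_real (LINT z|disk_measure. cmod z ^ n) = 0"
    by (simp add: disk_moment_def integral_complex_of_real[symmetric] del: integral_complex_of_real)
  then have "(LINT z|disk_measure. cmod z ^ n) = 0" by simp
  moreover have "integrable disk_measure (\<lambda>z. cmod z ^ n)"
    by (rule integrable_disk_bounded[of _ 1]) (auto simp: power_le_one)
  ultimately have "AE z in disk_measure. cmod z ^ n = 0"
    by (subst (asm) integral_nonneg_eq_0_iff_AE) auto
  with AE_disk_measure_ne_0 have "AE z in disk_measure. False"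
    by eventually_elim auto
  then have "AE z in lebesgue. z \<notin> unit_disk" by (simp add: AE_disk_measure)
  then have "negligible unit_disk"
    unfolding negligible_iff_null_sets by (subst AE_iff_null_sets) auto
  then show False using open_not_negligible[of unit_disk] by auto
qed

text \<open>The coefficient is the one for which the radial factor of the remainder has vanishing
  moment of order |m|; by \<open>angular_orthogonal_harmonic\<close> that single condition gives
  orthogonality to the whole space.\<close>

lemma bergman_proj_angular:
  assumes meas [measurable]: "h \<in> borel_measurable disk_measure" and "radial h"
    and bd: "\<And>z. z \<in> unit_disk \<Longrightarrow> norm (h z) \<le> B"
    and f: "\<And>z. z \<in> unit_disk \<Longrightarrow> f z = angular m z * h z"
  shows "bergman_proj f
    = (\<lambda>z. disk_moment h (nat \<bar>m\<bar>) / disk_moment (\<lambda>_. 1) (2 * nat \<bar>m\<bar>) * harmonic_monomial m z)"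
proof (rule bergman_proj_eqI)
  define n where "n = nat \<bar>m\<bar>"
  define c where "c = disk_moment h n / disk_moment (\<lambda>_. 1) (2 * n)"
  have B0: "B \<ge> 0" using order_trans[OF norm_ge_zero bd[of 0]] by simp
  show "f \<in> L2_disk"
  proof (rule L2_disk_bounded[of _ B])
    have "(\<lambda>z. angular m z * h z) \<in> borel_measurable disk_measure" by measurable
    then show "f \<in> borel_measurable disk_measure"
      by (subst measurable_cong[where g = "\<lambda>z. angular m z * h z"]) (simp_all add: f)
  qed (simp add: f bd norm_mult)
  show "(\<lambda>z. disk_moment h (nat \<bar>m\<bar>) / disk_moment (\<lambda>_. 1) (2 * nat \<bar>m\<bar>) * harmonic_monomial m z)
      \<in> harmonic_bergman"
    by (rule harmonic_bergman_scaled_monomial)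
  fix v assume v: "v \<in> harmonic_bergman"
  define g where "g = (\<lambda>z. h z - c * of_real (cmod z) ^ n)"
  have "(LINT z|disk_measure. angular m z * g z * cnj (v z)) = 0"
  proof (rule angular_orthogonal_harmonic[OF _ _ _ _ v])
    show "g \<in> borel_measurable disk_measure" unfolding g_def by measurable
    show "radial g" using \<open>radial h\<close> unfolding radial_def g_def by metis
    show "norm (g z) \<le> B + norm c" if "z \<in> unit_disk" for z
    proof -
      have "norm (c * of_real (cmod z) ^ n) \<le> norm c"
        using that by (simp add: norm_mult norm_power mult_left_le power_le_one)
      then show ?thesis unfolding g_def
        using bd[OF that] norm_triangle_ineq4[of "h z" "c * of_real (cmod z) ^ n"] by linarith
    qed
    have i: "integrable disk_measure (\<lambda>z. h z * of_real (cmod z) ^ n)"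
    proof (rule integrable_disk_bounded[of _ "B"])
      fix z assume z: "z \<in> unit_disk"
      have "norm (h z) * cmod z ^ n \<le> B * 1"
        using bd[OF z] z B0 by (intro mult_mono) (auto intro: power_le_one)
      then show "norm (h z * of_real (cmod z) ^ n) \<le> B" by (simp add: norm_mult norm_power)
    qed measurable
    have j: "integrable disk_measure (\<lambda>z. complex_of_real (cmod z) ^ (2 * n))"
      by (rule integrable_disk_bounded[of _ 1]) (auto simp: power_le_one norm_power)
    have "(LINT z|disk_measure. g z * of_real (cmod z) ^ n)
        = (LINT z|disk_measure. h z * of_real (cmod z) ^ n - c * of_real (cmod z) ^ (2 * n))"
      by (simp add: g_def left_diff_distrib mult_2 power_add mult.assoc)
    also have "\<dots> = disk_moment h n - c * disk_moment (\<lambda>_. 1) (2 * n)"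
      using i j by (simp add: disk_moment_def)
    also have "\<dots> = 0" using disk_moment_1_ne_0[of "2 * n"] by (simp add: c_def)
    finally show "(LINT z|disk_measure. g z * of_real (cmod z) ^ nat \<bar>m\<bar>) = 0" by (simp add: n_def)
  qed
  also have "(LINT z|disk_measure. angular m z * g z * cnj (v z))
      = L2_inner (\<lambda>z. f z - c * harmonic_monomial m z) v"
    unfolding L2_inner_def
    by (rule Bochner_Integration.integral_cong[OF refl])
      (simp add: f harmonic_monomial_in_disk g_def n_def algebra_simps)
  finally show "L2_inner (\<lambda>z. f z - disk_moment h (nat \<bar>m\<bar>) / disk_moment (\<lambda>_. 1) (2 * nat \<bar>m\<bar>)
      * harmonic_monomial m z) v = 0"
    by (simp add: c_def n_def)
qed

section \<open>Toeplitz operators\<close>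

lemma not_summable_on_inverse_nat: "\<not> (\<lambda>n. 1 / real n) summable_on {0<..}"
proof
  assume "(\<lambda>n. 1 / real n) summable_on {0<..}"
  \<comment> \<open>Index 0 may be added because \<open>1 / real 0\<close> is 0.\<close>
  also have "?this \<longleftrightarrow> (\<lambda>n. 1 / real n) summable_on UNIV"
    by (rule summable_on_cong_neutral) auto
  also have "\<dots> \<longleftrightarrow> summable (\<lambda>n. 1 / real n)"
    by (rule summable_on_UNIV_nonneg_real_iff) auto
  finally show False
    using not_summable_harmonic[where 'a = real] by (simp add: inverse_eq_divide)
qed

lemma not_summable_on_inverse_multiples:
  assumes "q > 0"
  shows "\<not> (\<lambda>n. 1 / real n) summable_on ((\<lambda>k. k * q) ` {0<..})"
proof
  assume "(\<lambda>n. 1 / real n) summable_on ((\<lambda>k. k * q) ` {0<..})"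
  then have "((\<lambda>n. 1 / real n) \<circ> (\<lambda>k. k * q)) summable_on {0<..}"
    using assms by (subst summable_on_reindex[symmetric]) (auto simp: inj_on_def)
  then have "(\<lambda>k. real q * (((\<lambda>n. 1 / real n) \<circ> (\<lambda>k. k * q)) k)) summable_on {0<..}"
    by (rule summable_on_cmult_right)
  then show False
    using not_summable_on_inverse_nat assms by (simp add: o_def)
qed

lemma radial_mellin_of_nat_eq_moment: "n > 0 \<Longrightarrow> radial_mellin f (of_nat n) = disk_moment f (2 * n)"
  by (simp add: radial_mellin_of_nat disk_moment_def)

text \<open>The Mellin transform is bounded and holomorphic, so zeros on the sparse set
  \<open>S\<close> spread to the whole half-plane and hence to all positive integers.\<close>

lemma sparse_moments_0_imp_AE_0:
  assumes meas [measurable]: "f \<in> borel_measurable disk_measure" and "radial f"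
    and bd: "\<And>z. z \<in> unit_disk \<Longrightarrow> norm (f z) \<le> B"
    and S: "\<And>n. n \<in> S \<Longrightarrow> n > 0 \<and> disk_moment f (2 * n) = 0"
    and div: "\<not> (\<lambda>n. 1 / real n) summable_on S"
  shows "AE z in disk_measure. f z = 0"
proof -
  have B0: "B \<ge> 0" using order_trans[OF norm_ge_zero bd[of 0]] by simp
  have zero: "radial_mellin f s = 0" if "Re s > 0" for s
  proof (rule bounded_holomorphic_halfplane_eq_0[OF _ _ _ div that])
    show "radial_mellin f holomorphic_on {s. 0 < Re s}"
      by (rule holomorphic_radial_mellin[OF meas bd])
    show "norm (radial_mellin f s) \<le> B * measure disk_measure unit_disk" if "Re s > 0" for s
      by (rule norm_radial_mellin_le[OF meas bd]) (use that in auto)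
  qed (use S radial_mellin_of_nat_eq_moment in auto)
  \<comment> \<open>The point 0 lies on the boundary of the half-plane, so the moment of order 0 is
    not reached. Multiplying by |z|^2 shifts every order to a positive one, and this factor vanishes
    only at the origin.\<close>
  have "AE z in disk_measure. f z * of_real (cmod z) ^ 2 = 0"
  proof (rule radial_moments_0_imp_AE_0)
    show "(\<lambda>z. f z * of_real (cmod z) ^ 2) \<in> borel_measurable disk_measure" by measurable
    show "radial (\<lambda>z. f z * of_real (cmod z) ^ 2)"
      using \<open>radial f\<close> unfolding radial_def by metis
    show "norm (f z * of_real (cmod z) ^ 2) \<le> B" if z: "z \<in> unit_disk" for z
    proof -
      have "norm (f z) * cmod z ^ 2 \<le> B * 1"
        using bd[OF z] z B0 by (intro mult_mono) (auto intro: power_le_one)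
      then show ?thesis by (simp add: norm_mult norm_power)
    qed
    fix n
    have "0 = radial_mellin f (of_nat (Suc n))" by (rule zero[symmetric]) simp
    also have "\<dots> = (LINT z|disk_measure. f z * of_real (cmod z) ^ (2 * Suc n))"
      by (rule radial_mellin_of_nat) simp
    also have "\<dots> = (LINT z|disk_measure. f z * of_real (cmod z) ^ 2 * of_real (cmod z) ^ (2 * n))"
      by (simp add: power2_eq_square mult_ac)
    finally show "(LINT z|disk_measure. f z * of_real (cmod z) ^ 2 * of_real (cmod z) ^ (2 * n)) = 0" ..
  qed
  with AE_disk_measure_ne_0 show ?thesis
    by eventually_elim auto
qed

lemma disk_moment_mult_power: "disk_moment (\<lambda>z. f z * of_real (cmod z) ^ k) n = disk_moment f (k + n)"
  by (simp add: disk_moment_def power_add mult_ac)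

lemma disk_moment_cmult: "disk_moment (\<lambda>z. c * f z) n = c * disk_moment f n"
  unfolding disk_moment_def mult.assoc by (rule integral_mult_right_zero)

text \<open>The scalar \<open>c\<close> gives input and output the same shape, so two such operators
  can be composed by applying the formula twice; \<open>p = 0\<close> covers radial symbols.\<close>

lemma toeplitz_quasihomogeneous_monomial:
  assumes meas [measurable]: "\<phi> \<in> borel_measurable disk_measure" and "radial \<phi>"
    and bd: "\<And>z. z \<in> unit_disk \<Longrightarrow> norm (\<phi> z) \<le> B"
    and f: "\<And>z. z \<in> unit_disk \<Longrightarrow> f z = angular p z * \<phi> z"
  shows "toeplitz f (\<lambda>z. c * harmonic_monomial m z)
    = (\<lambda>z. (c * disk_moment \<phi> (nat \<bar>m\<bar> + nat \<bar>p + m\<bar>) / disk_moment (\<lambda>_. 1) (2 * nat \<bar>p + m\<bar>))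
        * harmonic_monomial (p + m) z)"
proof -
  define h where "h = (\<lambda>z. c * (\<phi> z * of_real (cmod z) ^ nat \<bar>m\<bar>))"
  have B0: "B \<ge> 0" using order_trans[OF norm_ge_zero bd[of 0]] by simp
  have "bergman_proj (\<lambda>z. f z * (c * harmonic_monomial m z))
    = (\<lambda>z. disk_moment h (nat \<bar>p + m\<bar>) / disk_moment (\<lambda>_. 1) (2 * nat \<bar>p + m\<bar>)
        * harmonic_monomial (p + m) z)"
  proof (rule bergman_proj_angular)
    show "h \<in> borel_measurable disk_measure" unfolding h_def by measurable
    show "radial h" using \<open>radial \<phi>\<close> unfolding radial_def h_def by metis
    show "norm (h z) \<le> norm c * B" if z: "z \<in> unit_disk" for z
    proof -
      have "norm (\<phi> z) * cmod z ^ nat \<bar>m\<bar> \<le> B * 1"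
        using bd[OF z] z B0 by (intro mult_mono) (auto intro: power_le_one)
      then show ?thesis by (simp add: h_def norm_mult norm_power mult_left_mono)
    qed
    show "f z * (c * harmonic_monomial m z) = angular (p + m) z * h z" if "z \<in> unit_disk" for z
      using that by (simp add: f h_def harmonic_monomial_in_disk angular_add)
  qed
  then show ?thesis
    by (simp add: toeplitz_def h_def disk_moment_cmult disk_moment_mult_power)
qed

theorem theorem3:
  fixes p :: int and \<phi> \<psi> :: "complex \<Rightarrow> complex"
  assumes "p \<noteq> 0"
    and "bounded_symbol \<phi>" and "radial \<phi>"
    and "bounded_symbol \<psi>" and "radial \<psi>"
    and "\<forall>u\<in>harmonic_bergman.
           toeplitz (quasihomogeneous p \<phi>) (toeplitz \<psi> u)
             = toeplitz \<psi> (toeplitz (quasihomogeneous p \<phi>) u)"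
  shows "(AE z in disk_measure. \<phi> z = 0) \<or> (\<exists>c. AE z in disk_measure. \<psi> z = c)"
proof -
  obtain B where \<phi>: "\<phi> \<in> borel_measurable disk_measure" "\<And>z. z \<in> unit_disk \<Longrightarrow> norm (\<phi> z) \<le> B"
    using \<open>bounded_symbol \<phi>\<close> unfolding bounded_symbol_def bounded_iff by blast
  obtain C where \<psi>: "\<psi> \<in> borel_measurable disk_measure" "\<And>z. z \<in> unit_disk \<Longrightarrow> norm (\<psi> z) \<le> C"
    using \<open>bounded_symbol \<psi>\<close> unfolding bounded_symbol_def bounded_iff by blast
  note [measurable] = \<phi>(1) \<psi>(1)
  have B0: "B \<ge> 0" using order_trans[OF norm_ge_zero \<phi>(2)[of 0]] by simp
  have quasi: "quasihomogeneous p \<phi> z = angular p z * \<phi> z" if "z \<in> unit_disk" for z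
    using \<open>radial \<phi>\<close>[unfolded radial_def, rule_format, of "of_real (cmod z)" z] that
    by (simp add: quasihomogeneous_def angular_def)
  have plain: "\<psi> z = angular 0 z * \<psi> z" for z by (simp add: angular_def)
  define D where "D = disk_moment (\<lambda>_. 1)"
  define \<Lambda> where "\<Lambda> = (\<lambda>k. disk_moment \<psi> (2 * k) / D (2 * k))"
  have D0: "D k \<noteq> 0" for k unfolding D_def by (rule disk_moment_1_ne_0)
  have T\<phi>: "toeplitz (quasihomogeneous p \<phi>) (\<lambda>z. c * harmonic_monomial m z)
      = (\<lambda>z. (c * disk_moment \<phi> (nat \<bar>m\<bar> + nat \<bar>p + m\<bar>) / D (2 * nat \<bar>p + m\<bar>))
          * harmonic_monomial (p + m) z)" for c m
    unfolding D_def
    by (rule toeplitz_quasihomogeneous_monomial[OF \<phi>(1) \<open>radial \<phi>\<close> \<phi>(2) quasi])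
  have T\<psi>: "toeplitz \<psi> (\<lambda>z. c * harmonic_monomial m z) = (\<lambda>z. c * \<Lambda> (nat \<bar>m\<bar>) * harmonic_monomial m z)" for c m
    using toeplitz_quasihomogeneous_monomial[OF \<psi>(1) \<open>radial \<psi>\<close> \<psi>(2) plain, folded D_def, of c m]
    by (simp add: \<Lambda>_def mult_2)
  define q where "q = nat \<bar>p\<bar>"
  have q: "q > 0" using \<open>p \<noteq> 0\<close> by (simp add: q_def)
  have comm: "disk_moment \<phi> (2 * n + q) = 0 \<or> \<Lambda> n = \<Lambda> (n + q)" for n
  proof -
    \<comment> \<open>The sign makes \<open>\<bar>m + p\<bar> = \<bar>m\<bar> + \<bar>p\<bar>\<close>.\<close>
    define m where "m = sgn p * int n"
    have m: "nat \<bar>m\<bar> = n" "nat \<bar>p + m\<bar> = n + q"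
      using \<open>p \<noteq> 0\<close> by (auto simp: m_def q_def sgn_if abs_mult)
    have "toeplitz (quasihomogeneous p \<phi>) (toeplitz \<psi> (\<lambda>z. 1 * harmonic_monomial m z))
        = toeplitz \<psi> (toeplitz (quasihomogeneous p \<phi>) (\<lambda>z. 1 * harmonic_monomial m z))"
      using assms(6) harmonic_bergman_scaled_monomial by blast
    then have "\<Lambda> n * disk_moment \<phi> (n + (n + q)) / D (2 * (n + q)) * harmonic_monomial (p + m) z
        = disk_moment \<phi> (n + (n + q)) / D (2 * (n + q)) * \<Lambda> (n + q) * harmonic_monomial (p + m) z" for z
      unfolding T\<psi> T\<phi> m by (auto simp: fun_eq_iff)
    \<comment> \<open>At this point of the disk the argument is 0 and the monomial is a power of
      1/2, so it can be cancelled.\<close>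
    from this[of "1 / 2"] have "\<Lambda> n * disk_moment \<phi> (n + (n + q)) / D (2 * (n + q))
        = disk_moment \<phi> (n + (n + q)) / D (2 * (n + q)) * \<Lambda> (n + q)"
      by (simp add: harmonic_monomial_def angular_def)
    then show ?thesis using D0 by (auto simp: mult_2 add.assoc)
  qed
  define S where "S = {n. n > 0 \<and> disk_moment \<phi> (2 * n + q) = 0}"
  show ?thesis
  proof (cases "(\<lambda>n. 1 / real n) summable_on S")
    case False
    \<comment> \<open>The factor r^q turns moments of order \<open>2 n + q\<close> of \<phi> into
      even moments of the product.\<close>
    have "AE z in disk_measure. \<phi> z * of_real (cmod z) ^ q = 0"
    proof (rule sparse_moments_0_imp_AE_0[OF _ _ _ _ False])
      show "(\<lambda>z. \<phi> z * of_real (cmod z) ^ q) \<in> borel_measurable disk_measure" by measurable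
      show "radial (\<lambda>z. \<phi> z * of_real (cmod z) ^ q)"
        using \<open>radial \<phi>\<close> unfolding radial_def by metis
      show "norm (\<phi> z * of_real (cmod z) ^ q) \<le> B" if z: "z \<in> unit_disk" for z
      proof -
        have "norm (\<phi> z) * cmod z ^ q \<le> B * 1"
          using \<phi>(2)[OF z] z B0 by (intro mult_mono) (auto intro: power_le_one)
        then show ?thesis by (simp add: norm_mult norm_power)
      qed
    qed (auto simp: S_def disk_moment_mult_power add.commute)
    with AE_disk_measure_ne_0 have "AE z in disk_measure. \<phi> z = 0"
      by eventually_elim auto
    then show ?thesis ..
  next
    case True
    define S' where "S' = {0<..} - S"
    have "S \<union> S' = {0<..}" by (auto simp: S_def S'_def)
    then have div: "\<not> (\<lambda>n. 1 / real n) summable_on S'"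
      using True not_summable_on_inverse_nat summable_on_Un_disjoint[of "\<lambda>n. 1 / real n" S S']
      by (auto simp: S'_def)
    define M1 where "M1 = radial_mellin \<psi>"
    define M2 where "M2 = radial_mellin (\<lambda>_. 1)"
    have one: "(\<lambda>_. 1) \<in> borel_measurable disk_measure" "\<And>z. z \<in> unit_disk \<Longrightarrow> norm (1 :: complex) \<le> 1"
      by auto
    have hol: "M1 holomorphic_on {s. Re s > 0}" "M2 holomorphic_on {s. Re s > 0}"
      unfolding M1_def M2_def by (rule holomorphic_radial_mellin[OF \<psi>] holomorphic_radial_mellin[OF one]; simp)+
    have bnd: "norm (M1 s) \<le> C * measure disk_measure unit_disk" "norm (M2 s) \<le> 1 * measure disk_measure unit_disk"
      if "Re s > 0" for s
      unfolding M1_def M2_def using norm_radial_mellin_le[OF \<psi>, where s = s] norm_radial_mellin_le[OF one, where s = s] that by auto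
    \<comment> \<open>The numerator of \<Lambda>(s) - \<Lambda>(s + q) after interpolating \<Lambda>
      by \<open>M1 / M2\<close>: sums of products of bounded transforms stay bounded, and at
      positive integers the nonzero \<open>D\<close> allows dividing back.\<close>
    define F where "F = (\<lambda>s. M1 s * M2 (s + of_nat q) - M1 (s + of_nat q) * M2 s)"
    have F_nat: "F (of_nat n) = disk_moment \<psi> (2 * n) * D (2 * (n + q)) - disk_moment \<psi> (2 * (n + q)) * D (2 * n)"
      if "n > 0" for n
      using radial_mellin_of_nat_eq_moment[of n] radial_mellin_of_nat_eq_moment[of "n + q"] that
      by (simp add: F_def M1_def M2_def D_def)
    have "F s = 0" if "Re s > 0" for s
    proof (rule bounded_holomorphic_halfplane_eq_0[OF _ _ _ div that])
      have shift: "(\<lambda>s. M (s + of_nat q)) holomorphic_on {s. Re s > 0}"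
        if "M holomorphic_on {s. Re s > 0}" for M
      proof -
        have "M \<circ> (\<lambda>s. s + of_nat q) holomorphic_on {s. Re s > 0}"
          by (rule holomorphic_on_compose_gen[OF _ that]) (auto intro!: holomorphic_intros)
        then show ?thesis by (simp add: o_def)
      qed
      show "F holomorphic_on {s. 0 < Re s}"
        unfolding F_def by (intro holomorphic_intros hol shift)
      define K where "K = C * measure disk_measure unit_disk * (1 * measure disk_measure unit_disk)"
      show "norm (F s) \<le> K + K" if s: "Re s > 0" for s
      proof -
        have s': "Re (s + of_nat q) > 0" using s by simp
        have "norm (M1 s * M2 (s + of_nat q)) \<le> K" "norm (M1 (s + of_nat q) * M2 s) \<le> K"
          unfolding K_def norm_mult
          by (intro mult_mono' bnd s s' norm_ge_zero)+
        then show ?thesis unfolding F_def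
          using norm_triangle_ineq4[of "M1 s * M2 (s + of_nat q)" "M1 (s + of_nat q) * M2 s"] by linarith
      qed
      show "n > 0 \<and> F (of_nat n) = 0" if "n \<in> S'" for n
      proof -
        have n: "n > 0" "disk_moment \<phi> (2 * n + q) \<noteq> 0" using that by (auto simp: S_def S'_def)
        then have "\<Lambda> n = \<Lambda> (n + q)" using comm[of n] by simp
        then show ?thesis using n D0 by (simp add: F_nat \<Lambda>_def frac_eq_eq)
      qed
    qed
    then have period: "\<Lambda> n = \<Lambda> (n + q)" if "n > 0" for n
      using F_nat[OF that] that D0 by (simp add: \<Lambda>_def frac_eq_eq)
    \<comment> \<open>The recurrence is available for positive indices only, so the chain starts at
      \<open>q\<close>.\<close>
    have const: "\<Lambda> (Suc k * q) = \<Lambda> q" for k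
    proof (induction k)
      case (Suc k)
      have "\<Lambda> (Suc k * q) = \<Lambda> (Suc k * q + q)" using q by (intro period) simp
      then show ?case using Suc by (simp add: algebra_simps)
    qed simp
    have "AE z in disk_measure. \<psi> z - \<Lambda> q = 0"
    proof (rule sparse_moments_0_imp_AE_0[OF _ _ _ _ not_summable_on_inverse_multiples[OF q]])
      show "(\<lambda>z. \<psi> z - \<Lambda> q) \<in> borel_measurable disk_measure" by measurable
      show "radial (\<lambda>z. \<psi> z - \<Lambda> q)" using \<open>radial \<psi>\<close> unfolding radial_def by metis
      show "norm (\<psi> z - \<Lambda> q) \<le> C + norm (\<Lambda> q)" if "z \<in> unit_disk" for z
        using \<psi>(2)[OF that] norm_triangle_ineq4[of "\<psi> z" "\<Lambda> q"] by linarith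
      fix n assume "n \<in> (\<lambda>k. k * q) ` {0<..}"
      then obtain j where "j > 0" "n = j * q" by auto
      then obtain k where n: "n = Suc k * q" by (metis gr0_conv_Suc)
      then have n0: "n > 0" using q by simp
      have "\<Lambda> n = \<Lambda> q" using const[of k] n by simp
      then have eq: "disk_moment \<psi> (2 * n) = \<Lambda> q * D (2 * n)" using D0[of "2 * n"] by (simp add: \<Lambda>_def field_simps)
      have "integrable disk_measure (\<lambda>z. \<psi> z * of_real ((cmod z)\<^sup>2) powr of_nat n)"
        "integrable disk_measure (\<lambda>z. (1::complex) * of_real ((cmod z)\<^sup>2) powr of_nat n)"
        by (rule integrable_mellin_integrand[OF \<psi>] integrable_mellin_integrand[OF one]; simp)+
      then have "radial_mellin (\<lambda>z. \<psi> z - \<Lambda> q) (of_nat n) = M1 (of_nat n) - \<Lambda> q * M2 (of_nat n)"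
        by (simp add: radial_mellin_def M1_def M2_def left_diff_distrib)
      then have "disk_moment (\<lambda>z. \<psi> z - \<Lambda> q) (2 * n) = disk_moment \<psi> (2 * n) - \<Lambda> q * D (2 * n)"
        using n0 by (simp add: radial_mellin_of_nat_eq_moment M1_def M2_def D_def)
      then show "n > 0 \<and> disk_moment (\<lambda>z. \<psi> z - \<Lambda> q) (2 * n) = 0" using n0 eq by simp
    qed
    then have "AE z in disk_measure. \<psi> z = \<Lambda> q" by simp
    then show ?thesis by blast
  qed
qed

end
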